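(* Let $F(z)=D+C(zI-A)^{-1}B$ and consider triplets of matrices $(\Pi,H,\Lambda)$ satisfying $$(\ast)\qquad\begin{bmatrix}A&B\\C&D\end{bmatrix}\begin{bmatrix}\Pi\\H\end{bmatrix}=\begin{bmatrix}\Pi\Lambda\\0\end{bmatrix}.$$ (i) Assume that $(C,A)$ is observable. Then there exist a pair $(H_{fzk},\Lambda_{fzk})$ and a matrix $\Pi_{fzk}$ such that for every strictly proper rational $q$-tuple $g\in F^{-1}(\Omega Y)+\Omega U$ there exists a vector $\alpha$ for which $$g(z)-H_{fzk}(zI-\Lambda_{fzk})^{-1}\alpha\in\ker F\cap z^{-1}\Omega_\infty U;$$ furthermore $(\Pi_{fzk},H_{fzk},\Lambda_{fzk})$ satisfies $(\ast)$ and the kernel of $\Pi_{fzk}$ is trivial. (ii) If $(\Pi_1,H_1,\Lambda_1)$ satisfies $(\ast)$, then there exists a triple $(\Pi',H',\Lambda')$ satisfying $(\ast)$ such that $\ker\Pi'=\{0\}$, $\operatorname{Im}\Pi'=\operatorname{Im}\Pi_1$, and the columns of $H'(zI-\Lambda')^{-1}$ generate the same equivalence classes with respect to $\ker F\cap z^{-1}\Omega_\infty U$ as those of $H_1(zI-\Lambda_1)^{-1}$. Moreover, if $(C,A)$ is observable and $\operatorname{Im}\Pi_1\subset\langle A\mid B\rangle$, then $\operatorname{Im}\Pi_1\subset\operatorname{Im}\Pi_{fzk}$, where $\Pi_{fzk}$ is as in part (i). (iii) Assume that $(C,A)$ is observable. Let $(\Pi_1,H_1,\Lambda_1)$ satisfy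 $(\ast)$ and let $G_1$ be a column vector. Then $H_1(zI-\Lambda_1)^{-1}G_1\in F^{-1}(\Omega Y)+\Omega U$ if and only if $\Pi_1G_1\in\langle A\mid B\rangle$.
   Context: $A\in\mathbb C^{n\times n}$, $B\in\mathbb C^{n\times q}$, $C\in\mathbb C^{p\times n}$, $D\in\mathbb C^{p\times q}$; $F$ acts as a $\mathbb C(z)$-linear map $\mathbb C(z)^q\to\mathbb C(z)^p$. $\Omega U=\mathbb C[z]^q$ and $\Omega Y=\mathbb C[z]^p$ are the polynomial tuples; $z^{-1}\Omega_\infty U$ is the set of strictly proper rational $q$-tuples; $\ker F=\{g\in\mathbb C(z)^q:Fg=0\}$; $F^{-1}(\Omega Y)=\{g\in\mathbb C(z)^q:Fg\in\Omega Y\}$; $\langle A\mid B\rangle=\operatorname{Im}[B,AB,A^2B,\dots]$. That two families of strictly proper functions generate the same equivalence classes with respect to $\ker F\cap z^{-1}\Omega_\infty U$ means that their classes span the same complex linear subspace of the quotient by $\ker F\cap z^{-1}\Omega_\infty U$. *)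

theory Defs
  imports
    "Jordan_Normal_Form.Char_Poly"
    "Jordan_Normal_Form.Gauss_Jordan_Elimination"
    "Jordan_Normal_Form.Matrix_Kernel"
    "Jordan_Normal_Form.VS_Connect"
    "HOL-Computational_Algebra.Polynomial_Factorial"
    "HOL-Algebra.AbelCoset"
begin

text \<open>Dimensions are carried by the matrices (\<open>dim_row\<close>, \<open>dim_col\<close>), so the triples below may
  have any number of columns, including none.\<close>

type_synonym ratfun = "complex poly fract"

definition rat_const :: "complex \<Rightarrow> ratfun" where
  "rat_const c = to_fract [:c:]"

abbreviation const_mat :: "complex mat \<Rightarrow> ratfun mat" where
  "const_mat \<equiv> map_mat rat_const"

abbreviation const_vec :: "complex vec \<Rightarrow> ratfun vec" where
  "const_vec \<equiv> map_vec rat_const"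

text \<open>The matrix \<open>(zI - A)\<inverse>\<close>. Here \<open>char_poly_matrix A\<close> is \<open>zI - A\<close>.\<close>

definition resolvent :: "complex mat \<Rightarrow> ratfun mat" where
  "resolvent A = the (mat_inverse (map_mat to_fract (char_poly_matrix A)))"

lemma resolvent_inverse:
  assumes A: "A \<in> carrier_mat n n"
  shows "resolvent A \<in> carrier_mat n n"
    and "map_mat to_fract (char_poly_matrix A) * resolvent A = 1\<^sub>m n"
    and "resolvent A * map_mat to_fract (char_poly_matrix A) = 1\<^sub>m n"
proof -
  interpret hom: comm_ring_hom "to_fract :: complex poly \<Rightarrow> ratfun"
    by unfold_locales auto
  let ?M = "map_mat to_fract (char_poly_matrix A)"
  have M: "?M \<in> carrier_mat n n" using A by simp
  have "char_poly A \<noteq> 0" using degree_monic_char_poly[OF A] by auto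
  then have "det ?M \<noteq> 0" by (simp add: hom.hom_det char_poly_def)
  then have "?M \<in> Units (ring_mat TYPE(ratfun) n ())" by (rule det_non_zero_imp_unit[OF M])
  then obtain R where R: "mat_inverse ?M = Some R"
    using mat_inverse(1)[OF M, where b = "()"] by (cases "mat_inverse ?M") auto
  from mat_inverse(2)[OF M R] R
  show "resolvent A \<in> carrier_mat n n" "?M * resolvent A = 1\<^sub>m n" "resolvent A * ?M = 1\<^sub>m n"
    by (auto simp: resolvent_def)
qed

definition transfer_function ::
    "complex mat \<Rightarrow> complex mat \<Rightarrow> complex mat \<Rightarrow> complex mat \<Rightarrow> ratfun mat" where
  "transfer_function A B C D = const_mat D + const_mat C * resolvent A * const_mat B"

definition observable :: "complex mat \<Rightarrow> complex mat \<Rightarrow> bool" where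
  "observable C A \<longleftrightarrow> (\<Inter>i. mat_kernel (C * A ^\<^sub>m i)) = {0\<^sub>v (dim_row A)}"

text \<open>\<open>\<langle>A | B\<rangle>\<close>: the image of the matrix with infinitely many columns \<open>[B, AB, A\<^sup>2B, \<dots>]\<close>, i.e. the
  set of finite linear combinations of its columns.\<close>

definition reachable_space :: "complex mat \<Rightarrow> complex mat \<Rightarrow> complex vec set" where
  "reachable_space A B =
     LinearCombinations.module.span class_ring (module_vec TYPE(complex) (dim_row A))
       (\<Union>i. set (cols (A ^\<^sub>m i * B)))"

definition mat_image :: "complex mat \<Rightarrow> complex vec set" where
  "mat_image M = (\<lambda>x. M *\<^sub>v x) ` carrier_vec (dim_col M)"

definition poly_tuples :: "nat \<Rightarrow> ratfun vec set" where
  "poly_tuples m = map_vec to_fract ` carrier_vec m"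

definition strictly_proper :: "ratfun \<Rightarrow> bool" where
  "strictly_proper f \<longleftrightarrow> (\<exists>a b. b \<noteq> 0 \<and> f = Fract a b \<and> (a = 0 \<or> degree a < degree b))"

definition strictly_proper_tuples :: "nat \<Rightarrow> ratfun vec set" where
  "strictly_proper_tuples m = {g \<in> carrier_vec m. \<forall>i<m. strictly_proper (g $ i)}"

definition poly_preimage :: "ratfun mat \<Rightarrow> ratfun vec set" where
  "poly_preimage F = {g \<in> carrier_vec (dim_col F). F *\<^sub>v g \<in> poly_tuples (dim_row F)}"

text \<open>\<open>F\<inverse>(\<Omega>Y) + \<Omega>U\<close>\<close>

definition poly_preimage_plus_poly :: "ratfun mat \<Rightarrow> ratfun vec set" where
  "poly_preimage_plus_poly F = {h + u | h u. h \<in> poly_preimage F \<and> u \<in> poly_tuples (dim_col F)}"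

definition strictly_proper_kernel :: "ratfun mat \<Rightarrow> ratfun vec set" where
  "strictly_proper_kernel F = mat_kernel F \<inter> strictly_proper_tuples (dim_col F)"

definition strictly_proper_space :: "nat \<Rightarrow> (complex, ratfun vec) module" where
  "strictly_proper_space m =
     \<lparr>carrier = strictly_proper_tuples m, mult = undefined, one = undefined, zero = 0\<^sub>v m,
      add = (+), smult = (\<lambda>c g. rat_const c \<cdot>\<^sub>v g)\<rparr>"

text \<open>The quotient module. The multiple \<open>c (x + K)\<close> is the coset \<open>K + {c y | y \<in> x + K}\<close>; adding
  \<open>K\<close> matters only for \<open>c = 0\<close>.\<close>

definition quotient_space ::
    "('a, 'b, 'm) module_scheme \<Rightarrow> 'b set \<Rightarrow> ('a, 'b set) module" where
  "quotient_space V K =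
     \<lparr>carrier = a_rcosets\<^bsub>V\<^esub> K, mult = undefined, one = undefined, zero = K,
      add = (\<lambda>X Y. X <+>\<^bsub>V\<^esub> Y), smult = (\<lambda>c X. K <+>\<^bsub>V\<^esub> ((\<lambda>x. c \<odot>\<^bsub>V\<^esub> x) ` X))\<rparr>"

lemma quotient_space_smult_coset:
  assumes "module R V" "submodule R K V" "c \<in> carrier R" "v \<in> carrier V"
  shows "c \<odot>\<^bsub>quotient_space V K\<^esub> (K +>\<^bsub>V\<^esub> v) = K +>\<^bsub>V\<^esub> (c \<odot>\<^bsub>V\<^esub> v)"
proof -
  interpret V: module R V by fact
  interpret K: submodule R K V by fact
  have sub: "\<And>k. k \<in> K \<Longrightarrow> k \<in> carrier V" using K.subset by auto
  show ?thesis
    unfolding quotient_space_def a_r_coset_def' set_add_def'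
  proof (simp, intro equalityI subsetI)
    fix x assume "x \<in> (\<Union>h\<in>K. \<Union>x\<in>K. {h \<oplus>\<^bsub>V\<^esub> c \<odot>\<^bsub>V\<^esub> (x \<oplus>\<^bsub>V\<^esub> v)})"
    then obtain h k where hk: "h \<in> K" "k \<in> K" "x = h \<oplus>\<^bsub>V\<^esub> c \<odot>\<^bsub>V\<^esub> (k \<oplus>\<^bsub>V\<^esub> v)" by auto
    then have "x = (h \<oplus>\<^bsub>V\<^esub> c \<odot>\<^bsub>V\<^esub> k) \<oplus>\<^bsub>V\<^esub> c \<odot>\<^bsub>V\<^esub> v"
      using assms sub by (simp add: V.smult_r_distr V.a_assoc)
    moreover have "h \<oplus>\<^bsub>V\<^esub> c \<odot>\<^bsub>V\<^esub> k \<in> K" using hk assms by auto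
    ultimately show "x \<in> (\<Union>h\<in>K. {h \<oplus>\<^bsub>V\<^esub> c \<odot>\<^bsub>V\<^esub> v})" by auto
  next
    fix x assume "x \<in> (\<Union>h\<in>K. {h \<oplus>\<^bsub>V\<^esub> c \<odot>\<^bsub>V\<^esub> v})"
    then obtain h where "h \<in> K" "x = h \<oplus>\<^bsub>V\<^esub> c \<odot>\<^bsub>V\<^esub> v" by auto
    then have "x = h \<oplus>\<^bsub>V\<^esub> c \<odot>\<^bsub>V\<^esub> (\<zero>\<^bsub>V\<^esub> \<oplus>\<^bsub>V\<^esub> v)" using assms by simp
    then show "x \<in> (\<Union>h\<in>K. \<Union>x\<in>K. {h \<oplus>\<^bsub>V\<^esub> c \<odot>\<^bsub>V\<^esub> (x \<oplus>\<^bsub>V\<^esub> v)})"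
      using \<open>h \<in> K\<close> K.zero_closed by blast
  qed
qed

lemma quotient_space_module:
  assumes "module R V" "submodule R K V"
  shows "module R (quotient_space V K)"
proof -
  interpret V: module R V by fact
  interpret K: submodule R K V by fact
  have sub: "\<And>k. k \<in> K \<Longrightarrow> k \<in> carrier V" using K.subset by auto
  have "subgroup K (add_monoid V)"
  proof (rule V.add.subgroupI)
    show "K \<subseteq> carrier V" by (rule K.subset)
    show "K \<noteq> {}" using K.zero_closed by blast
    show "\<ominus>\<^bsub>V\<^esub> a \<in> K" if "a \<in> K" for a
    proof -
      have "\<ominus>\<^bsub>V\<^esub> a = (\<ominus>\<^bsub>R\<^esub> \<one>\<^bsub>R\<^esub>) \<odot>\<^bsub>V\<^esub> a" using sub[OF that] by (simp add: V.smult_l_minus)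
      then show ?thesis using that by auto
    qed
    show "a \<oplus>\<^bsub>V\<^esub> b \<in> K" if "a \<in> K" "b \<in> K" for a b using that by auto
  qed
  then interpret K: abelian_subgroup K V
    by (intro abelian_subgroupI3 additive_subgroup.intro V.abelian_group_axioms)
  let ?Q = "quotient_space V K"
  have car: "carrier ?Q = (\<lambda>v. K +>\<^bsub>V\<^esub> v) ` carrier V"
    by (auto simp: quotient_space_def A_RCOSETS_def')
  have add: "(K +>\<^bsub>V\<^esub> x) \<oplus>\<^bsub>?Q\<^esub> (K +>\<^bsub>V\<^esub> y) = K +>\<^bsub>V\<^esub> (x \<oplus>\<^bsub>V\<^esub> y)"
    if "x \<in> carrier V" "y \<in> carrier V" for x y
    using K.a_rcos_sum[OF that] by (simp add: quotient_space_def)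
  have zero: "\<zero>\<^bsub>?Q\<^esub> = K +>\<^bsub>V\<^esub> \<zero>\<^bsub>V\<^esub>"
    using V.a_coset_add_zero[OF K.a_subset] by (simp add: quotient_space_def)
  have grp: "abelian_group ?Q"
  proof (rule abelian_groupI)
    fix X assume "X \<in> carrier ?Q"
    then obtain x where x: "x \<in> carrier V" "X = K +>\<^bsub>V\<^esub> x" by (auto simp: car)
    then have "(K +>\<^bsub>V\<^esub> (\<ominus>\<^bsub>V\<^esub> x)) \<oplus>\<^bsub>?Q\<^esub> X = \<zero>\<^bsub>?Q\<^esub>"
      by (simp add: add zero V.l_neg)
    with x show "\<exists>Y\<in>carrier ?Q. Y \<oplus>\<^bsub>?Q\<^esub> X = \<zero>\<^bsub>?Q\<^esub>" by (auto simp: car)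
  qed (auto simp: car add zero V.a_ac)
  note smult = quotient_space_smult_coset[OF assms]
  show ?thesis
    by (rule moduleI[OF V.R.is_cring grp])
      (auto simp: car add smult V.smult_l_distr V.smult_r_distr V.smult_assoc1)
qed

lemma rat_const_simps:
  "rat_const 0 = 0" "rat_const 1 = 1"
  "rat_const (a + b) = rat_const a + rat_const b" "rat_const (a * b) = rat_const a * rat_const b"
  by (simp_all add: rat_const_def flip: to_fract_add to_fract_mult one_pCons)

lemma strictly_proper_0: "strictly_proper 0"
  unfolding strictly_proper_def by (intro exI[of _ 0] exI[of _ 1]) (simp add: Zero_fract_def)

lemma strictly_proper_add:
  assumes "strictly_proper f" "strictly_proper g"
  shows "strictly_proper (f + g)"
proof -
  from assms obtain a b c d where f: "b \<noteq> 0" "f = Fract a b" "a = 0 \<or> degree a < degree b"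
    and g: "d \<noteq> 0" "g = Fract c d" "c = 0 \<or> degree c < degree d"
    unfolding strictly_proper_def by blast
  have "a * d + c * b = 0 \<or> degree (a * d + c * b) < degree (b * d)"
  proof (cases "a = 0 \<or> c = 0")
    case True
    then show ?thesis using f g by (auto simp: degree_mult_eq)
  next
    case False
    then show ?thesis using f g
      by (intro disjI2 degree_add_less) (auto simp: degree_mult_eq)
  qed
  moreover have "f + g = Fract (a * d + c * b) (b * d)" using f g by simp
  moreover have "b * d \<noteq> 0" using f g by simp
  ultimately show ?thesis unfolding strictly_proper_def by blast
qed

lemma strictly_proper_smult:
  assumes "strictly_proper f"
  shows "strictly_proper (rat_const c * f)"
proof -
  from assms obtain a b where f: "b \<noteq> 0" "f = Fract a b" "a = 0 \<or> degree a < degree b"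
    unfolding strictly_proper_def by blast
  then have "rat_const c * f = Fract (Polynomial.smult c a) b"
    by (simp add: rat_const_def to_fract_def)
  moreover have "Polynomial.smult c a = 0 \<or> degree (Polynomial.smult c a) < degree b"
    using f degree_smult_le[of c a] by auto
  ultimately show ?thesis using f unfolding strictly_proper_def by blast
qed

lemma strictly_proper_space_module: "module class_ring (strictly_proper_space m)"
proof -
  have neg: "- g \<in> strictly_proper_tuples m" if "g \<in> strictly_proper_tuples m" for g
  proof -
    have "rat_const (- 1) = - 1"
      by (metis rat_const_simps(1-3) add.right_inverse add_eq_0_iff)
    then have "strictly_proper (- (g $ i))" if "i < m" for i
      using strictly_proper_smult[of "g $ i" "-1"] \<open>g \<in> _\<close> that
      by (simp add: strictly_proper_tuples_def)
    then show ?thesis using that by (auto simp: strictly_proper_tuples_def)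
  qed
  show ?thesis
  proof (rule moduleI)
    show "cring (class_ring :: complex ring)" by (rule module.axioms(1)[OF vec_module])
    show "abelian_group (strictly_proper_space m)"
    proof (rule abelian_groupI)
      fix g assume "g \<in> carrier (strictly_proper_space m)"
      then have g: "g \<in> strictly_proper_tuples m" by (simp add: strictly_proper_space_def)
      then have "- g + g = 0\<^sub>v m"
        by (intro uminus_l_inv_vec) (simp add: strictly_proper_tuples_def)
      with neg[OF g] show "\<exists>h \<in> carrier (strictly_proper_space m).
          h \<oplus>\<^bsub>strictly_proper_space m\<^esub> g = \<zero>\<^bsub>strictly_proper_space m\<^esub>"
        by (auto simp: strictly_proper_space_def)
    qed (auto simp: strictly_proper_space_def strictly_proper_tuples_def strictly_proper_0
          strictly_proper_add assoc_add_vec intro: comm_add_vec)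
  qed (auto simp: strictly_proper_space_def strictly_proper_tuples_def class_ring_simps
      strictly_proper_smult rat_const_simps add_smult_distrib_vec smult_add_distrib_vec
      smult_smult_assoc)
qed

lemma strictly_proper_kernel_submodule:
  "submodule class_ring (strictly_proper_kernel F) (strictly_proper_space (dim_col F))"
proof -
  have F: "F \<in> carrier_mat (dim_row F) (dim_col F)" by simp
  show ?thesis
    by (rule submodule.intro[OF strictly_proper_space_module])
      (auto simp: strictly_proper_kernel_def strictly_proper_space_def strictly_proper_tuples_def
        mat_kernel_def strictly_proper_0 strictly_proper_add strictly_proper_smult
        mult_add_distrib_mat_vec[OF F] mult_mat_vec[OF F])
qed

text \<open>The complex subspace of \<open>z\<inverse>\<Omega>\<^sub>\<infinity>U / (ker F \<inter> z\<inverse>\<Omega>\<^sub>\<infinity>U)\<close> spanned by the classes of the columns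
  of \<open>M\<close>; it is meant for matrices with strictly proper entries.\<close>

definition generated_classes :: "ratfun mat \<Rightarrow> ratfun mat \<Rightarrow> ratfun vec set set" where
  "generated_classes F M =
     (let V = strictly_proper_space (dim_col F); K = strictly_proper_kernel F
      in LinearCombinations.module.span class_ring (quotient_space V K)
           ((\<lambda>v. K +>\<^bsub>V\<^esub> v) ` set (cols M)))"

text \<open>\<open>P\<close> stands for the matrix \<open>\<Pi>\<close>, whose name is reserved for the dependent function space.\<close>

definition zero_triple ::
    "complex mat \<Rightarrow> complex mat \<Rightarrow> complex mat \<Rightarrow> complex mat \<Rightarrow>
     complex mat \<Rightarrow> complex mat \<Rightarrow> complex mat \<Rightarrow> bool" where
  "zero_triple A B C D P H \<Lambda> \<longleftrightarrow>
     (\<exists>k. P \<in> carrier_mat (dim_row A) k \<and> H \<in> carrier_mat (dim_col B) k \<and> \<Lambda> \<in> carrier_mat k k \<and>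
          four_block_mat A B C D * (P @\<^sub>r H) = (P * \<Lambda>) @\<^sub>r 0\<^sub>m (dim_row C) k)"

text \<open>A solution triple with \<open>ker \<Pi> = {0}\<close> that represents, modulo \<open>ker F \<inter> z\<inverse>\<Omega>\<^sub>\<infinity>U\<close>, every strictly
  proper element of \<open>F\<inverse>(\<Omega>Y) + \<Omega>U\<close>; such triples are not unique.\<close>

definition fzk_triple ::
    "complex mat \<Rightarrow> complex mat \<Rightarrow> complex mat \<Rightarrow> complex mat \<Rightarrow>
     complex mat \<Rightarrow> complex mat \<Rightarrow> complex mat \<Rightarrow> bool" where
  "fzk_triple A B C D P H \<Lambda> \<longleftrightarrow>
     zero_triple A B C D P H \<Lambda> \<and>
     mat_kernel P = {0\<^sub>v (dim_col P)} \<and>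
     (\<forall>g \<in> strictly_proper_tuples (dim_col B) \<inter>
            poly_preimage_plus_poly (transfer_function A B C D).
        \<exists>\<alpha> \<in> carrier_vec (dim_col H).
          g - (const_mat H * resolvent \<Lambda>) *\<^sub>v const_vec \<alpha>
            \<in> strictly_proper_kernel (transfer_function A B C D))"

end

theory Submission
  imports Defs
begin

text \<open>
  Everything is read off the state equation \<open>z x = A x + B g + v\<close>, in which \<open>v\<close> is a constant
  vector (an initial state), \<open>g\<close> an input and \<open>x\<close> a state. It determines
  \<open>x = (zI - A)\<inverse>(B g + v)\<close>, and its output is \<open>C x + D g = F g + C(zI - A)\<inverse>v\<close>
  (\<open>state_space_output\<close>). For a solution triple \<open>(\<Pi>, H, \<Lambda>)\<close> and a constant \<open>\<alpha>\<close>, the state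
  \<open>\<Pi>(zI - \<Lambda>)\<inverse>\<alpha>\<close> and the input \<open>g = H(zI - \<Lambda>)\<inverse>\<alpha>\<close> solve the equation with \<open>v = \<Pi>\<alpha>\<close> and
  have output zero, so \<open>F g = - C(zI - A)\<inverse>\<Pi>\<alpha>\<close> (\<open>zero_triple_response\<close>). Modulo
  \<open>ker F\<close>, the function \<open>g\<close> therefore depends on \<open>\<Pi>\<alpha>\<close> only.

  Polynomial inputs are handled by the reachable space: up to polynomials, the functions
  \<open>(zI - A)\<inverse>B u\<close> with \<open>u\<close> polynomial are exactly the functions \<open>(zI - A)\<inverse>w\<close> with
  \<open>w \<in> \<langle>A | B\<rangle>\<close>. Hence \<open>g \<in> F\<inverse>(\<Omega>Y) + \<Omega>U\<close> if and only if \<open>F g + C(zI - A)\<inverse>w\<close> is polynomial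
  for some reachable \<open>w\<close> (\<open>poly_preimage_plus_poly_iff\<close>). Under observability a polynomial
  \<open>C(zI - A)\<inverse>v\<close> forces \<open>v = 0\<close>. Applied to \<open>F g = - C(zI - A)\<inverse>\<Pi>\<alpha>\<close> this gives (iii):
  the only possible \<open>w\<close> is \<open>\<Pi>\<alpha>\<close>.

  For (i) and (ii), a subspace \<open>V\<close> of the state space is called output nulling if each
  \<open>v \<in> V\<close> admits an input value \<open>h\<close> with \<open>A v + B h \<in> V\<close> and \<open>C v + D h = 0\<close>. The image of
  \<open>\<Pi>\<close> in a solution triple is output nulling; conversely, writing these conditions for the
  vectors of a basis turns an output-nulling \<open>V\<close> into a solution triple whose \<open>\<Pi>\<close> is injective
  with image \<open>V\<close>. This reduces a triple without changing the image of \<open>\<Pi>\<close>, and triples with the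
  same image generate the same classes, which is the first half of (ii).
  For (i), take the space of all initial states from which a strictly proper input and a strictly
  proper state trajectory produce output zero. Comparing the coefficients of \<open>1/z\<close> shows that it
  is output nulling. If \<open>g\<close> is strictly proper and \<open>F g + C(zI - A)\<inverse>w\<close> is polynomial, then this
  output is also strictly proper, hence zero; so \<open>w\<close> lies in that space, \<open>w = \<Pi>\<alpha>\<close>, and
  \<open>g - H(zI - \<Lambda>)\<inverse>\<alpha>\<close> lies in \<open>ker F\<close>. The second half of (ii) combines (iii), the defining
  property of the triple in (i) and observability.

  The strictly proper parts are treated without power series: a strictly proper \<open>f\<close>
  satisfies \<open>z f = c + f'\<close> with \<open>c\<close> constant and \<open>f'\<close> strictly proper, and the decomposition of a
  rational function into a polynomial and a strictly proper part is unique.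
\<close>

section \<open>Tuples of rational functions\<close>

interpretation to_fract_hom: inj_comm_ring_hom "to_fract :: complex poly \<Rightarrow> ratfun"
  by unfold_locales auto

interpretation rat_const_hom: inj_comm_ring_hom rat_const
  by unfold_locales (auto simp: rat_const_simps, simp add: rat_const_def)

definition indet :: ratfun where "indet = to_fract [:0, 1:]"

lemma strictly_proper_poly_zero:
  assumes "strictly_proper (to_fract p)"
  shows "p = 0"
proof (rule ccontr)
  assume p: "p \<noteq> 0"
  from assms obtain a b where ab: "b \<noteq> 0" "to_fract p = Fract a b" "a = 0 \<or> degree a < degree b"
    unfolding strictly_proper_def by blast
  then have eq: "p * b = a" by (simp add: to_fract_def eq_fract)
  with p ab have "degree a = degree p + degree b" by (auto simp: degree_mult_eq)
  with eq p ab show False by auto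
qed

lemma ratfun_decompose: "\<exists>p s. strictly_proper s \<and> f = to_fract p + s"
proof -
  obtain a b where f: "f = Fract a b" "b \<noteq> 0" by (cases f) auto
  have "f = to_fract (a div b) + Fract (a mod b) b"
    using f(2) by (simp add: f to_fract_def eq_fract)
  moreover have "strictly_proper (Fract (a mod b) b)"
    unfolding strictly_proper_def using f(2) degree_mod_less by blast
  ultimately show ?thesis by blast
qed

text \<open>Long division of \<open>z a\<close> by \<open>b\<close>: for \<open>deg a < deg b\<close> the quotient is constant. It is the
  coefficient of \<open>1/z\<close> in the expansion of \<open>a/b\<close> at infinity, and \<open>s\<close> is the shifted tail of
  that expansion.\<close>
lemma strictly_proper_shift:
  assumes "strictly_proper f"
  shows "\<exists>c s. strictly_proper s \<and> indet * f = rat_const c + s"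
proof -
  from assms obtain a b where ab: "b \<noteq> 0" "f = Fract a b" "a = 0 \<or> degree a < degree b"
    unfolding strictly_proper_def by blast
  show ?thesis
  proof (cases "a = 0")
    case True
    then have "indet * f = rat_const 0 + 0"
      using ab by (simp add: rat_const_simps Zero_fract_def eq_fract indet_def to_fract_def)
    then show ?thesis using strictly_proper_0 by blast
  next
    case False
    define q where "q = pCons 0 a div b"
    have "degree (pCons 0 a) \<le> degree b" using ab False by (simp add: Suc_le_eq)
    moreover have "degree (pCons 0 a mod b) \<le> degree b"
      using degree_mod_less[OF ab(1), of "pCons 0 a"] by auto
    moreover have "b * q = pCons 0 a - pCons 0 a mod b" by (simp add: q_def minus_mod_eq_mult_div)
    ultimately have "degree (b * q) \<le> degree b" by (metis degree_diff_le)
    then have "degree q = 0" using ab(1) by (cases "q = 0") (auto simp: degree_mult_eq)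
    then obtain c where q: "q = [:c:]" by (rule degree_eq_zeroE)
    have "pCons 0 a = b * q + pCons 0 a mod b" by (simp add: q_def)
    then have "indet * f = rat_const c + Fract (pCons 0 a mod b) b"
      using ab(1) by (simp add: ab(2) indet_def rat_const_def to_fract_def eq_fract q algebra_simps)
    moreover have "strictly_proper (Fract (pCons 0 a mod b) b)"
      unfolding strictly_proper_def using ab(1) degree_mod_less by blast
    ultimately show ?thesis by blast
  qed
qed

abbreviation (input) sp where "sp \<equiv> strictly_proper_tuples"

lemma strictly_proper_tuples_carrier: "g \<in> sp m \<Longrightarrow> g \<in> carrier_vec m"
  by (simp add: strictly_proper_tuples_def)

lemma strictly_proper_tuples_zero: "0\<^sub>v m \<in> sp m"
  by (simp add: strictly_proper_tuples_def strictly_proper_0)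

lemma strictly_proper_tuples_add: "g \<in> sp m \<Longrightarrow> h \<in> sp m \<Longrightarrow> g + h \<in> sp m"
  by (auto simp: strictly_proper_tuples_def strictly_proper_add)

lemma strictly_proper_tuples_smult: "g \<in> sp m \<Longrightarrow> rat_const c \<cdot>\<^sub>v g \<in> sp m"
  by (auto simp: strictly_proper_tuples_def strictly_proper_smult)

lemma strictly_proper_tuples_uminus: "g \<in> sp m \<Longrightarrow> - g \<in> sp m"
proof -
  assume g: "g \<in> sp m"
  have "- g = rat_const (- 1) \<cdot>\<^sub>v g" by (intro eq_vecI) (auto simp: rat_const_hom.hom_uminus)
  then show "- g \<in> sp m" using strictly_proper_tuples_smult[OF g, of "- 1"] by simp
qed

lemma strictly_proper_tuples_diff:
  "g \<in> sp m \<Longrightarrow> h \<in> sp m \<Longrightarrow> g - h \<in> sp m"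
  using strictly_proper_tuples_add[OF _ strictly_proper_tuples_uminus, of g m h]
  by (simp add: minus_add_uminus_vec[of g m h] strictly_proper_tuples_carrier)

lemma strictly_proper_sum: "(\<And>i. i \<in> I \<Longrightarrow> strictly_proper (f i)) \<Longrightarrow> strictly_proper (sum f I)"
  by (induct I rule: infinite_finite_induct) (auto simp: strictly_proper_0 strictly_proper_add)

lemma strictly_proper_tuples_mult:
  assumes M: "M \<in> carrier_mat k m" and g: "g \<in> sp m"
  shows "const_mat M *\<^sub>v g \<in> sp k"
  using assms
  by (auto simp: strictly_proper_tuples_def scalar_prod_def
      intro!: strictly_proper_sum strictly_proper_smult)

lemma poly_tuples_iff: "g \<in> poly_tuples m \<longleftrightarrow> (\<exists>P \<in> carrier_vec m. g = map_vec to_fract P)"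
  by (auto simp: poly_tuples_def)

lemma poly_tuples_carrier: "g \<in> poly_tuples m \<Longrightarrow> g \<in> carrier_vec m"
  by (auto simp: poly_tuples_def)

lemma map_vec_add:
  assumes "\<And>a b. h (a + b) = h a + h b" "v \<in> carrier_vec m" "w \<in> carrier_vec m"
  shows "map_vec h (v + w) = map_vec h v + map_vec h w"
  using assms by (intro eq_vecI) auto

lemma poly_tuples_zero: "0\<^sub>v m \<in> poly_tuples m"
  unfolding poly_tuples_iff by (intro bexI[of _ "0\<^sub>v m"]) auto

lemma poly_tuples_add: "g \<in> poly_tuples m \<Longrightarrow> h \<in> poly_tuples m \<Longrightarrow> g + h \<in> poly_tuples m"
proof -
  assume "g \<in> poly_tuples m" "h \<in> poly_tuples m"
  then obtain P Q where "P \<in> carrier_vec m" "Q \<in> carrier_vec m" "g = map_vec to_fract P" "h =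
      map_vec to_fract Q"
    by (auto simp: poly_tuples_iff)
  then show ?thesis unfolding poly_tuples_iff
    by (intro bexI[of _ "P + Q"]) (auto simp: map_vec_add[of to_fract P m Q])
qed

lemma poly_tuples_smult: "g \<in> poly_tuples m \<Longrightarrow> to_fract c \<cdot>\<^sub>v g \<in> poly_tuples m"
proof -
  assume "g \<in> poly_tuples m"
  then obtain P where "P \<in> carrier_vec m" "g = map_vec to_fract P"
    by (auto simp: poly_tuples_iff)
  then show ?thesis unfolding poly_tuples_iff
    by (intro bexI[of _ "c \<cdot>\<^sub>v P"]) (auto simp: to_fract_hom.vec_hom_smult)
qed

lemma poly_tuples_uminus: "g \<in> poly_tuples m \<Longrightarrow> - g \<in> poly_tuples m"
proof -
  assume g: "g \<in> poly_tuples m"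
  have "- g = to_fract (- 1) \<cdot>\<^sub>v g" by (intro eq_vecI) (auto simp: to_fract_hom.hom_uminus)
  then show "- g \<in> poly_tuples m" using poly_tuples_smult[OF g, of "- 1"] by simp
qed

lemma poly_tuples_diff:
  "g \<in> poly_tuples m \<Longrightarrow> h \<in> poly_tuples m \<Longrightarrow> g - h \<in> poly_tuples m"
  using poly_tuples_add[OF _ poly_tuples_uminus, of g m h]
  by (simp add: minus_add_uminus_vec[of g m h] poly_tuples_carrier)

lemma const_vec_poly: "v \<in> carrier_vec m \<Longrightarrow> const_vec v \<in> poly_tuples m"
  unfolding poly_tuples_iff
  by (intro bexI[of _ "map_vec (\<lambda>c. [:c:]) v"] eq_vecI) (auto simp: rat_const_def)

lemma const_mat_eq: "const_mat M = map_mat to_fract (map_mat (\<lambda>c. [:c:]) M)"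
  by (intro eq_matI) (auto simp: rat_const_def)

lemma poly_tuples_mult:
  assumes M: "M \<in> carrier_mat k m" and g: "g \<in> poly_tuples m"
  shows "const_mat M *\<^sub>v g \<in> poly_tuples k"
proof -
  obtain P where P: "P \<in> carrier_vec m" "g = map_vec to_fract P" using g by (auto simp: poly_tuples_iff)
  have M': "map_mat (\<lambda>c. [:c:]) M \<in> carrier_mat k m" using M by simp
  show ?thesis unfolding const_mat_eq P(2) poly_tuples_iff
    by (rule bexI[OF _ mult_mat_vec_carrier[OF M' P(1)]])
      (rule to_fract_hom.mult_mat_vec_hom[OF M' P(1), symmetric])
qed

lemma poly_strictly_proper_zero:
  assumes "g \<in> poly_tuples m" "g \<in> sp m"
  shows "g = 0\<^sub>v m"
proof -
  obtain P where P: "P \<in> carrier_vec m" "g = map_vec to_fract P" using assms by (auto simp: poly_tuples_iff)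
  show ?thesis using assms(2) P strictly_proper_poly_zero
    by (intro eq_vecI) (auto simp: strictly_proper_tuples_def)
qed

text \<open>This splits one equation between rational tuples into two, one for the polynomial and one for
  the strictly proper parts.\<close>
lemma poly_strictly_proper_unique:
  assumes y: "y \<in> poly_tuples m" "y' \<in> poly_tuples m" and s: "s \<in> sp m" "s' \<in> sp m"
    and eq: "y + s = y' + s'"
  shows "y = y'" "s = s'"
proof -
  note c = y[THEN poly_tuples_carrier] s[THEN strictly_proper_tuples_carrier]
  have e: "y $ i + s $ i = y' $ i + s' $ i" if "i < m" for i
    using arg_cong[OF eq, of "\<lambda>v. v $ i"] that c by simp
  have "y - y' = s' - s"
  proof (rule eq_vecI)
    fix i assume "i < dim_vec (s' - s)"
    then show "(y - y') $ i = (s' - s) $ i" using e[of i] c by (simp add: algebra_simps)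
  qed (use c in auto)
  then have "y - y' = 0\<^sub>v m" "s' - s = 0\<^sub>v m"
    using poly_strictly_proper_zero[of "y - y'" m] poly_tuples_diff[OF y]
      strictly_proper_tuples_diff[OF s(2,1)] by auto
  then have "\<And>i. i < m \<Longrightarrow> (y - y') $ i = 0" "\<And>i. i < m \<Longrightarrow> (s' - s) $ i = 0" by auto
  then show "y = y'" "s = s'" using c by (auto intro!: eq_vecI)
qed

lemma tuple_decompose:
  assumes "g \<in> carrier_vec m"
  obtains y s where "y \<in> poly_tuples m" "s \<in> sp m" "g = y + s"
proof -
  from ratfun_decompose obtain p s where ps: "\<And>f. strictly_proper (s f)" "\<And>f. f = to_fract (p f) + s f"
    by metis
  have "map_vec to_fract (map_vec p g) \<in> poly_tuples m" using assms by (auto simp: poly_tuples_def)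
  moreover have "map_vec s g \<in> sp m" using assms ps by (auto simp: strictly_proper_tuples_def)
  moreover have "g = map_vec to_fract (map_vec p g) + map_vec s g" using ps(2) assms by (intro eq_vecI) auto
  ultimately show ?thesis by (rule that)
qed

lemma tuple_shift:
  assumes "g \<in> sp m"
  obtains c s where "c \<in> carrier_vec m" "s \<in> sp m" "indet \<cdot>\<^sub>v g = const_vec c + s"
proof -
  from strictly_proper_shift obtain c s where cs:
    "\<And>f. strictly_proper f \<Longrightarrow> strictly_proper (s f)"
    "\<And>f. strictly_proper f \<Longrightarrow> indet * f = rat_const (c f) + s f" by metis
  have "map_vec c g \<in> carrier_vec m" "map_vec s g \<in> sp m"
    using assms cs by (auto simp: strictly_proper_tuples_def)
  moreover have "indet \<cdot>\<^sub>v g = const_vec (map_vec c g) + map_vec s g"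
    using cs(2) assms by (intro eq_vecI) (auto simp: strictly_proper_tuples_def)
  ultimately show ?thesis by (rule that)
qed

section \<open>Constant matrices and the resolvent\<close>

lemma const_mat_carrier: "M \<in> carrier_mat a b \<Longrightarrow> const_mat M \<in> carrier_mat a b" by simp

text \<open>Applications of the resolvent are replaced by an equation linear in \<open>x\<close>, so that the entries
  of the inverse matrix never have to be inspected.\<close>
lemma resolvent_eq_iff:
  assumes A: "A \<in> carrier_mat n n" and x: "x \<in> carrier_vec n" and v: "v \<in> carrier_vec n"
  shows "x = resolvent A *\<^sub>v v \<longleftrightarrow> indet \<cdot>\<^sub>v x = const_mat A *\<^sub>v x + v"
proof -
  define Z where "Z = map_mat to_fract (char_poly_matrix A)"
  have cA: "const_mat A \<in> carrier_mat n n" using A by simp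
  have Z: "Z \<in> carrier_mat n n" using A by (simp add: Z_def)
  note R = resolvent_inverse[OF A, folded Z_def]
  have "Z = indet \<cdot>\<^sub>m 1\<^sub>m n - const_mat A"
    unfolding Z_def char_poly_matrix_def indet_def rat_const_def using A
    by (intro eq_matI) (auto simp: to_fract_hom.hom_minus[symmetric] to_fract_hom.hom_uminus[symmetric])
  moreover have "(indet \<cdot>\<^sub>m 1\<^sub>m n) *\<^sub>v x = indet \<cdot>\<^sub>v x"
    using x by (intro eq_vecI) auto
  ultimately have Zx: "Z *\<^sub>v x = indet \<cdot>\<^sub>v x - const_mat A *\<^sub>v x"
    using x cA by (simp add: minus_mult_distrib_mat_vec[of _ n n])
  have Ax: "const_mat A *\<^sub>v x \<in> carrier_vec n" using cA x by simp
  have "x = resolvent A *\<^sub>v v \<longleftrightarrow> Z *\<^sub>v x = v"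
  proof
    assume "x = resolvent A *\<^sub>v v"
    then have "Z *\<^sub>v x = (Z * resolvent A) *\<^sub>v v" using assoc_mult_mat_vec[OF Z R(1) v] by simp
    then show "Z *\<^sub>v x = v" using R(2) v by simp
  next
    assume "Z *\<^sub>v x = v"
    then have "resolvent A *\<^sub>v v = (resolvent A * Z) *\<^sub>v x" using assoc_mult_mat_vec[OF R(1) Z x] by simp
    then show "x = resolvent A *\<^sub>v v" using R(3) x by simp
  qed
  also have "\<dots> \<longleftrightarrow> indet \<cdot>\<^sub>v x = const_mat A *\<^sub>v x + v"
    unfolding Zx vec_eq_iff using x v Ax cA by (auto simp: algebra_simps)
  finally show ?thesis .
qed

lemma resolvent_closed:
  "A \<in> carrier_mat n n \<Longrightarrow> v \<in> carrier_vec n \<Longrightarrow> resolvent A *\<^sub>v v \<in> carrier_vec n"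
  using resolvent_inverse(1) mult_mat_vec_carrier by blast

definition coeff_vec :: "nat \<Rightarrow> complex poly vec \<Rightarrow> complex vec" where
  "coeff_vec k P = map_vec (\<lambda>p. coeff p k) P"

lemma coeff_vec_carrier [simp]: "coeff_vec k P \<in> carrier_vec m \<longleftrightarrow> P \<in> carrier_vec m"
  by (auto simp: coeff_vec_def)

lemma coeff_vec_add:
  "P \<in> carrier_vec m \<Longrightarrow> Q \<in> carrier_vec m \<Longrightarrow> coeff_vec k (P + Q) = coeff_vec k P + coeff_vec k Q"
  by (auto simp: coeff_vec_def)

lemma coeff_vec_mult:
  assumes M: "M \<in> carrier_mat a b" and P: "P \<in> carrier_vec b"
  shows "coeff_vec k (map_mat (\<lambda>c. [:c:]) M *\<^sub>v P) = M *\<^sub>v coeff_vec k P"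
  using assms by (intro eq_vecI) (auto simp: coeff_vec_def scalar_prod_def coeff_sum)

lemma coeff_vec_eventually_zero:
  assumes P: "P \<in> carrier_vec m"
  obtains N where "\<And>k. N \<le> k \<Longrightarrow> coeff_vec k P = 0\<^sub>v m"
proof
  fix k
  assume k: "Suc (\<Sum>i<m. degree (P $ i)) \<le> k"
  have "degree (P $ i) < k" if "i < m" for i
    using k that member_le_sum[of i "{..<m}" "\<lambda>i. degree (P $ i)"] by simp
  then show "coeff_vec k P = 0\<^sub>v m"
    using P by (intro eq_vecI) (auto simp: coeff_vec_def coeff_eq_0)
qed

text \<open>The coefficient of \<open>z\<^sup>k\<^sup>+\<^sup>1\<close> in the equation expresses the \<open>k\<close>-th coefficient of \<open>Y\<close> through
  the next coefficients of \<open>U\<close> and \<open>Y\<close>, and the constant coefficient expresses \<open>w\<close> through the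
  first ones. The high coefficients of \<open>Y\<close> vanish, so by descending induction all coefficients,
  and at the end \<open>w\<close>, belong to every set \<open>S\<close> that contains \<open>0\<close> and is stable under the
  recursion. The set \<open>{0}\<close> shows that \<open>Y\<close> vanishes if there is no input, and the reachable space
  shows that \<open>w\<close> is reachable.\<close>
lemma poly_state_coefficients:
  assumes A: "A \<in> carrier_mat n n" and B: "B \<in> carrier_mat n q"
    and U: "U \<in> carrier_vec q" and Y: "Y \<in> carrier_vec n" and w: "w \<in> carrier_vec n"
    and eq: "const_mat B *\<^sub>v map_vec to_fract U + const_mat A *\<^sub>v map_vec to_fract Y =
      indet \<cdot>\<^sub>v map_vec to_fract Y + const_vec w"
    and zero: "0\<^sub>v n \<in> S"
    and step: "\<And>k a. a \<in> S \<Longrightarrow> B *\<^sub>v coeff_vec k U + A *\<^sub>v a \<in> S"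
  shows "coeff_vec k Y \<in> S" "w \<in> S"
proof -
  let ?A = "map_mat (\<lambda>c. [:c:]) A" and ?B = "map_mat (\<lambda>c. [:c:]) B"
  let ?w = "map_vec (\<lambda>c. [:c:]) w"
  have A': "?A \<in> carrier_mat n n" and B': "?B \<in> carrier_mat n q" using A B by auto
  have "map_vec to_fract (?B *\<^sub>v U + ?A *\<^sub>v Y) = map_vec to_fract ([:0,1:] \<cdot>\<^sub>v Y + ?w)"
  proof -
    have "map_vec to_fract (?B *\<^sub>v U + ?A *\<^sub>v Y) =
        map_vec to_fract (?B *\<^sub>v U) + map_vec to_fract (?A *\<^sub>v Y)"
      by (rule map_vec_add[OF _ mult_mat_vec_carrier[OF B' U] mult_mat_vec_carrier[OF A' Y]]) simp
    also have "\<dots> = const_mat B *\<^sub>v map_vec to_fract U + const_mat A *\<^sub>v map_vec to_fract Y"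
      unfolding const_mat_eq to_fract_hom.mult_mat_vec_hom[OF A' Y] to_fract_hom.mult_mat_vec_hom[OF B' U] ..
    also have "\<dots> = map_vec to_fract ([:0,1:] \<cdot>\<^sub>v Y + ?w)"
      unfolding eq using Y w
      by (intro eq_vecI) (auto simp: indet_def rat_const_def simp flip: to_fract_mult to_fract_add)
    finally show ?thesis .
  qed
  then have poly_eq: "?B *\<^sub>v U + ?A *\<^sub>v Y = [:0,1:] \<cdot>\<^sub>v Y + ?w" by (rule to_fract_hom.vec_hom_inj)
  have coeff_eq: "B *\<^sub>v coeff_vec k U + A *\<^sub>v coeff_vec k Y = coeff_vec k ([:0,1:] \<cdot>\<^sub>v Y + ?w)" for k
    unfolding poly_eq[symmetric] using A' B' U Y A B
    by (simp add: coeff_vec_add[of _ n] coeff_vec_mult)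
  have at_0: "coeff_vec 0 ([:0,1:] \<cdot>\<^sub>v Y + ?w) = w"
    using Y w by (intro eq_vecI) (auto simp: coeff_vec_def)
  have at_Suc: "coeff_vec (Suc k) ([:0,1:] \<cdot>\<^sub>v Y + ?w) = coeff_vec k Y" for k
    using Y w by (intro eq_vecI) (auto simp: coeff_vec_def)
  obtain N where N: "\<And>k. N \<le> k \<Longrightarrow> coeff_vec k Y = 0\<^sub>v n" using coeff_vec_eventually_zero[OF Y] by blast
  have coeff_in: "coeff_vec k Y \<in> S" if "k \<le> N" for k
    using that
  proof (induction rule: inc_induct)
    case base
    then show ?case using N zero by simp
  next
    case (step k)
    then show ?case using assms(8)[of "coeff_vec (Suc k) Y" "Suc k"] coeff_eq[of "Suc k"]
      by (simp add: at_Suc)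
  qed
  show "w \<in> S" using step[OF coeff_in[of 0], of 0] coeff_eq[of 0] by (simp add: at_0)
  show "coeff_vec k Y \<in> S" using coeff_in[of k] N[of k] zero by (cases "k \<le> N") auto
qed

text \<open>For the polynomial part \<open>y\<close> of the solution \<open>x\<close> of \<open>z x = A x + c + s\<close>, the polynomial parts of
  the equation give \<open>z y + c' = A y + c\<close> with a constant \<open>c'\<close>. The leading term of \<open>z y\<close> has
  nothing to cancel it, so \<open>y = 0\<close>.\<close>
lemma resolvent_strictly_proper:
  assumes A: "A \<in> carrier_mat n n" and c: "c \<in> carrier_vec n" and s: "s \<in> sp n"
  shows "resolvent A *\<^sub>v (const_vec c + s) \<in> sp n"
proof -
  define x where "x = resolvent A *\<^sub>v (const_vec c + s)"
  have sc: "s \<in> carrier_vec n" using s by (rule strictly_proper_tuples_carrier)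
  have x: "x \<in> carrier_vec n" unfolding x_def using A c sc by (simp add: resolvent_closed)
  have cA: "const_mat A \<in> carrier_mat n n" using A by simp
  obtain y t where y: "y \<in> poly_tuples n" and t: "t \<in> sp n" and xyt: "x = y + t"
    using tuple_decompose[OF x] .
  obtain c' t' where c': "c' \<in> carrier_vec n" and t': "t' \<in> sp n" and zt: "indet \<cdot>\<^sub>v t = const_vec c' + t'"
    using tuple_shift[OF t] .
  note [simp] = poly_tuples_carrier[OF y] strictly_proper_tuples_carrier[OF t]
    strictly_proper_tuples_carrier[OF t'] sc c c' cA
    mult_mat_vec_carrier[OF cA poly_tuples_carrier[OF y]]
    mult_mat_vec_carrier[OF cA strictly_proper_tuples_carrier[OF t]]
  note [simp] = poly_tuples_carrier[OF y, THEN carrier_vecD]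
    strictly_proper_tuples_carrier[OF t, THEN carrier_vecD]
    strictly_proper_tuples_carrier[OF t', THEN carrier_vecD] sc[THEN carrier_vecD] c[THEN carrier_vecD]
    c'[THEN carrier_vecD] carrier_matD[OF A]
  have "indet \<cdot>\<^sub>v x = const_mat A *\<^sub>v x + (const_vec c + s)"
    using resolvent_eq_iff[OF A x, of "const_vec c + s"] by (simp add: x_def)
  then have "indet \<cdot>\<^sub>v y + indet \<cdot>\<^sub>v t = (const_mat A *\<^sub>v y + const_mat A *\<^sub>v t) + (const_vec c + s)"
    by (simp add: xyt mult_add_distrib_mat_vec[OF cA] smult_add_distrib_vec[of _ n])
  then have "(indet \<cdot>\<^sub>v y + const_vec c') + t' =
      (const_mat A *\<^sub>v y + const_vec c) + (const_mat A *\<^sub>v t + s)"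
    unfolding zt by (simp add: vec_eq_iff algebra_simps)
  then have eq: "indet \<cdot>\<^sub>v y + const_vec c' = const_mat A *\<^sub>v y + const_vec c"
    by (rule poly_strictly_proper_unique(1)[rotated 4])
      (auto intro!: poly_tuples_add poly_tuples_mult[OF A] const_vec_poly strictly_proper_tuples_add
        strictly_proper_tuples_mult[OF A] s t t' y simp: indet_def poly_tuples_smult[OF y])
  obtain Y where Y: "Y \<in> carrier_vec n" "y = map_vec to_fract Y" using y by (auto simp: poly_tuples_iff)
  \<comment> \<open>the coefficient recursion without input, expressed by an input space of dimension \<open>0\<close>\<close>
  have "coeff_vec k Y \<in> {0\<^sub>v n}" for k
  proof (rule poly_state_coefficients(1)[OF A, of "0\<^sub>m n 0" 0 "0\<^sub>v 0" Y "c' - c"])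
    show "const_mat (0\<^sub>m n 0) *\<^sub>v map_vec to_fract (0\<^sub>v 0) + const_mat A *\<^sub>v map_vec to_fract Y =
        indet \<cdot>\<^sub>v map_vec to_fract Y + const_vec (c' - c)"
      using eq unfolding Y(2)[symmetric]
      by (simp add: vec_eq_iff scalar_prod_def rat_const_hom.hom_minus algebra_simps)
  qed (use A Y in \<open>auto simp: coeff_vec_def scalar_prod_def vec_eq_iff\<close>)
  then have "coeff (Y $ i) k = 0" if "i < n" for i k
    using that Y(1) by (simp add: coeff_vec_def vec_eq_iff)
  then have "Y = 0\<^sub>v n" using Y(1) by (intro eq_vecI) (auto intro: poly_eqI)
  then have "x = t" unfolding xyt Y(2) by (simp add: to_fract_hom.vec_hom_zero)
  then show ?thesis using t x_def by simp
qed

lemma resolvent_const_strictly_proper: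
  assumes A: "A \<in> carrier_mat n n" and c: "c \<in> carrier_vec n"
  shows "resolvent A *\<^sub>v const_vec c \<in> sp n"
  using resolvent_strictly_proper[OF A c strictly_proper_tuples_zero] c by simp

section \<open>Subspaces and their basis matrices\<close>

lemma smult_zero_right: "(c :: 'a :: mult_zero) \<cdot>\<^sub>v 0\<^sub>v m = 0\<^sub>v m"
  by (intro eq_vecI) auto

lemma mult_mat_vec_in_closed_set:
  fixes M :: "'a :: comm_ring_1 mat"
  assumes M: "M \<in> carrier_mat m k" and t: "t \<in> carrier_vec k"
    and zero: "0\<^sub>v m \<in> Q" and add: "\<And>v w. v \<in> Q \<Longrightarrow> w \<in> Q \<Longrightarrow> v + w \<in> Q"
    and cols: "\<And>j. j < k \<Longrightarrow> t $ j \<cdot>\<^sub>v col M j \<in> Q"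
  shows "M *\<^sub>v t \<in> Q"
proof -
  have "l \<le> k \<Longrightarrow> vec m (\<lambda>i. \<Sum>j<l. M $$ (i, j) * t $ j) \<in> Q" for l
  proof (induction l)
    case 0
    have "vec m (\<lambda>i. \<Sum>j<0. M $$ (i, j) * t $ j) = 0\<^sub>v m" by (intro eq_vecI) auto
    then show ?case using zero by simp
  next
    case (Suc l)
    have "vec m (\<lambda>i. \<Sum>j<Suc l. M $$ (i, j) * t $ j) =
        vec m (\<lambda>i. \<Sum>j<l. M $$ (i, j) * t $ j) + t $ l \<cdot>\<^sub>v col M l"
      using Suc.prems M by (intro eq_vecI) (auto simp: mult.commute)
    then show ?case using Suc add cols by simp
  qed
  moreover have "M *\<^sub>v t = vec m (\<lambda>i. \<Sum>j<k. M $$ (i, j) * t $ j)"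
    using M t by (intro eq_vecI) (auto simp: scalar_prod_def atLeast0LessThan)
  ultimately show ?thesis by simp
qed

text \<open>The columns of \<open>P\<close> enumerate a maximal linearly independent subset of \<open>V\<close>; for \<open>V = {0}\<close> there
  are none.\<close>
lemma subspace_has_basis_matrix:
  fixes V :: "complex vec set"
  assumes V: "submodule class_ring V (module_vec TYPE(complex) n)"
  obtains P k where "P \<in> carrier_mat n k" "mat_kernel P = {0\<^sub>v k}" "mat_image P = V"
proof -
  interpret E: vec_space "TYPE(complex)" n .
  have Vc: "V \<subseteq> carrier_vec n" using submodule.subset[OF V] by (simp add: module_vec_simps)
  define indep where "indep T \<longleftrightarrow> T \<subseteq> V \<and> E.lin_indpt T" for T
  have "\<exists>S. finite S \<and> maximal S indep"
  proof (rule maximal_exists)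
    show "finite S \<and> card S \<le> n" if "indep S" for S
    proof -
      have "S \<subseteq> carrier_vec n" "E.lin_indpt S" using that Vc by (auto simp: indep_def)
      from E.li_le_dim[OF E.fin_dim this] show ?thesis by (simp add: E.dim_is_n)
    qed
    show "indep {}" by (simp add: indep_def E.lin_dep_def)
  qed
  then obtain S where fin: "finite S" and S: "indep S" and max: "\<And>T. S \<subseteq> T \<Longrightarrow> indep T \<Longrightarrow> T = S"
    by (auto simp: maximal_def)
  have SV: "S \<subseteq> V" and li: "E.lin_indpt S" using S by (simp_all add: indep_def)
  have Sc: "S \<subseteq> carrier_vec n" using SV Vc by blast
  have span: "E.span S = V"
  proof
    show "E.span S \<subseteq> V" by (rule E.span_is_subset[OF SV V])
    show "V \<subseteq> E.span S"
    proof
      fix v assume v: "v \<in> V"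
      show "v \<in> E.span S"
      proof (cases "v \<in> S")
        case True
        then show ?thesis using E.in_own_span[OF Sc] by blast
      next
        case False
        have "E.lin_dep (S \<union> {v})"
        proof (rule ccontr)
          assume "E.lin_indpt (S \<union> {v})"
          then have "S \<union> {v} = S" using v SV by (intro max) (auto simp: indep_def)
          then show False using False by blast
        qed
        moreover have "v \<in> carrier_vec n" using v Vc by blast
        ultimately show ?thesis using E.lin_dep_iff_in_span[OF Sc li _ False] by simp
      qed
    qed
  qed
  obtain ws where ws: "set ws = S" "distinct ws" using finite_distinct_list[OF fin] by blast
  define P where "P = mat_of_cols n ws"
  have P: "P \<in> carrier_mat n (length ws)" by (simp add: P_def)
  have wsc: "set ws \<subseteq> carrier_vec n" using ws Sc by simp
  have "cols P = ws" unfolding P_def using wsc by (rule cols_mat_of_cols)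
  then have "E.col_space P = V" using span ws by (simp add: E.col_space_def)
  then have img: "mat_image P = V"
    unfolding E.col_space_eq[OF P] mat_image_def using P by fastforce
  have "x = 0\<^sub>v (length ws)" if x: "x \<in> carrier_vec (length ws)" and Px: "P *\<^sub>v x = 0\<^sub>v n" for x
  proof -
    define f where "f w = x $ (THE i. i < length ws \<and> ws ! i = w)" for w
    have f: "f (ws ! i) = x $ i" if "i < length ws" for i
    proof -
      have "(THE j. j < length ws \<and> ws ! j = ws ! i) = i"
        by (intro the_equality) (use that nth_eq_iff_index_eq[OF ws(2)] in blast)+
      then show ?thesis by (simp add: f_def)
    qed
    have "E.lincomb f (set ws) = E.lincomb_list (\<lambda>i. f (ws ! i)) ws"
      by (rule E.lincomb_as_lincomb_list_distinct[OF wsc ws(2)])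
    also have "\<dots> = P *\<^sub>v vec (length ws) (\<lambda>i. f (ws ! i))"
      unfolding P_def using wsc by (intro E.lincomb_list_as_mat_mult) auto
    also have "vec (length ws) (\<lambda>i. f (ws ! i)) = x" using x f by (intro eq_vecI) auto
    finally have "E.lincomb f (set ws) = 0\<^sub>v n" using Px by simp
    then have "f w = 0" if "w \<in> S" for w
      using li that fin unfolding ws(1) E.lin_dep_def by blast
    then have "x $ i = 0" if "i < length ws" for i
      unfolding f[OF that, symmetric] using ws(1) nth_mem[OF that] by simp
    then show ?thesis using x by (intro eq_vecI) auto
  qed
  moreover have "P *\<^sub>v 0\<^sub>v (length ws) = 0\<^sub>v n" using P by (intro eq_vecI) auto
  ultimately have "mat_kernel P = {0\<^sub>v (length ws)}"
    unfolding mat_kernel[OF P] using zero_carrier_vec[of "length ws", where ?'a = complex] by blast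
  then show ?thesis using that P img by blast
qed

lemma append_rows_eq_iff:
  assumes "X \<in> carrier_mat a k" "X' \<in> carrier_mat a k" "Y \<in> carrier_mat b k" "Y' \<in> carrier_mat b k"
  shows "X @\<^sub>r Y = X' @\<^sub>r Y' \<longleftrightarrow> X = X' \<and> Y = Y'"
proof
  assume eq: "X @\<^sub>r Y = X' @\<^sub>r Y'"
  have top: "(Z @\<^sub>r W) $$ (i, j) = Z $$ (i, j)"
      if "i < a" "j < k" "Z \<in> carrier_mat a k" "W \<in> carrier_mat b k" for Z W :: "'a mat" and i j
    using that by (auto simp: append_rows_def)
  have bot: "(Z @\<^sub>r W) $$ (a + i, j) = W $$ (i, j)"
      if "i < b" "j < k" "Z \<in> carrier_mat a k" "W \<in> carrier_mat b k" for Z W :: "'a mat" and i j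
    using that by (auto simp: append_rows_def)
  have "X = X'" using assms top[of _ _ X Y] top[of _ _ X' Y'] eq by (intro eq_matI) auto
  moreover have "Y = Y'" using assms bot[of _ _ X Y] bot[of _ _ X' Y'] eq by (intro eq_matI) auto
  ultimately show "X = X' \<and> Y = Y'" ..
qed simp

section \<open>Subspaces of the quotient by the strictly proper kernel\<close>

lemma quotient_space_add_coset:
  assumes "module R V" "submodule R K V" "x \<in> carrier V" "y \<in> carrier V"
  shows "(K +>\<^bsub>V\<^esub> x) \<oplus>\<^bsub>quotient_space V K\<^esub> (K +>\<^bsub>V\<^esub> y) = K +>\<^bsub>V\<^esub> (x \<oplus>\<^bsub>V\<^esub> y)"
proof -
  interpret V: module R V by fact
  interpret K: submodule R K V by fact
  have sub: "\<And>k. k \<in> K \<Longrightarrow> k \<in> carrier V" using K.subset by auto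
  show ?thesis
    unfolding quotient_space_def a_r_coset_def' set_add_def'
  proof (simp, intro equalityI subsetI)
    fix v assume "v \<in> (\<Union>h\<in>K. \<Union>k\<in>K. {h \<oplus>\<^bsub>V\<^esub> x \<oplus>\<^bsub>V\<^esub> (k \<oplus>\<^bsub>V\<^esub> y)})"
    then obtain h k where hk: "h \<in> K" "k \<in> K" "v = h \<oplus>\<^bsub>V\<^esub> x \<oplus>\<^bsub>V\<^esub> (k \<oplus>\<^bsub>V\<^esub> y)" by auto
    then have "v = (h \<oplus>\<^bsub>V\<^esub> k) \<oplus>\<^bsub>V\<^esub> (x \<oplus>\<^bsub>V\<^esub> y)"
      using assms(3,4) sub by (simp add: V.a_ac)
    then show "v \<in> (\<Union>h\<in>K. {h \<oplus>\<^bsub>V\<^esub> (x \<oplus>\<^bsub>V\<^esub> y)})" using K.m_closed[OF hk(1,2)] by blast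
  next
    fix v assume "v \<in> (\<Union>h\<in>K. {h \<oplus>\<^bsub>V\<^esub> (x \<oplus>\<^bsub>V\<^esub> y)})"
    then obtain h where h: "h \<in> K" "v = h \<oplus>\<^bsub>V\<^esub> (x \<oplus>\<^bsub>V\<^esub> y)" by auto
    then have "v = h \<oplus>\<^bsub>V\<^esub> x \<oplus>\<^bsub>V\<^esub> (\<zero>\<^bsub>V\<^esub> \<oplus>\<^bsub>V\<^esub> y)" using assms(3,4) sub by (simp add: V.a_assoc)
    then show "v \<in> (\<Union>h\<in>K. \<Union>k\<in>K. {h \<oplus>\<^bsub>V\<^esub> x \<oplus>\<^bsub>V\<^esub> (k \<oplus>\<^bsub>V\<^esub> y)})"
      using h(1) K.zero_closed by blast
  qed
qed

lemma coset_add_submodule_element: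
  assumes "module R V" "submodule R K V" "k \<in> K" "x \<in> carrier V"
  shows "K +>\<^bsub>V\<^esub> (k \<oplus>\<^bsub>V\<^esub> x) = K +>\<^bsub>V\<^esub> x"
proof -
  interpret V: module R V by fact
  interpret K: submodule R K V by fact
  have sub: "\<And>k. k \<in> K \<Longrightarrow> k \<in> carrier V" using K.subset by auto
  have neg: "\<ominus>\<^bsub>V\<^esub> k \<in> K"
  proof -
    have "\<ominus>\<^bsub>V\<^esub> k = (\<ominus>\<^bsub>R\<^esub> \<one>\<^bsub>R\<^esub>) \<odot>\<^bsub>V\<^esub> k" using sub[OF assms(3)] by (simp add: V.smult_l_minus)
    then show ?thesis using assms(3) by auto
  qed
  show ?thesis unfolding a_r_coset_def'
  proof (intro equalityI subsetI)
    fix v assume "v \<in> (\<Union>h\<in>K. {h \<oplus>\<^bsub>V\<^esub> (k \<oplus>\<^bsub>V\<^esub> x)})"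
    then obtain h where h: "h \<in> K" "v = h \<oplus>\<^bsub>V\<^esub> (k \<oplus>\<^bsub>V\<^esub> x)" by auto
    then have "v = (h \<oplus>\<^bsub>V\<^esub> k) \<oplus>\<^bsub>V\<^esub> x" using assms(3,4) sub by (simp add: V.a_assoc)
    then show "v \<in> (\<Union>h\<in>K. {h \<oplus>\<^bsub>V\<^esub> x})" using K.m_closed[OF h(1) assms(3)] by blast
  next
    fix v assume "v \<in> (\<Union>h\<in>K. {h \<oplus>\<^bsub>V\<^esub> x})"
    then obtain h where h: "h \<in> K" "v = h \<oplus>\<^bsub>V\<^esub> x" by auto
    have "\<ominus>\<^bsub>V\<^esub> k \<oplus>\<^bsub>V\<^esub> (k \<oplus>\<^bsub>V\<^esub> x) = x"
      using assms(3,4) sub by (simp add: V.a_assoc[symmetric] V.l_neg)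
    then have "v = (h \<oplus>\<^bsub>V\<^esub> \<ominus>\<^bsub>V\<^esub> k) \<oplus>\<^bsub>V\<^esub> (k \<oplus>\<^bsub>V\<^esub> x)"
      using h assms(3,4) sub by (simp add: V.a_assoc)
    then show "v \<in> (\<Union>h\<in>K. {h \<oplus>\<^bsub>V\<^esub> (k \<oplus>\<^bsub>V\<^esub> x)})" using K.m_closed[OF h(1) neg] by blast
  qed
qed

text \<open>The vectors whose class lies in the span of the classes of the columns of \<open>M2\<close> form a complex
  subspace that contains the columns of \<open>M2\<close>, hence all combinations \<open>M2 t\<close> with constant \<open>t\<close>, and
  hence everything that differs from such a combination by an element of the kernel.\<close>
lemma generated_classes_subset:
  assumes M1: "set (cols M1) \<subseteq> sp (dim_col F)" and M2: "set (cols M2) \<subseteq> sp (dim_col F)"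
    and dim: "dim_row M2 = dim_col F"
    and rep: "\<And>g. g \<in> set (cols M1) \<Longrightarrow>
      \<exists>t \<in> carrier_vec (dim_col M2). g - M2 *\<^sub>v const_vec t \<in> strictly_proper_kernel F"
  shows "generated_classes F M1 \<subseteq> generated_classes F M2"
proof -
  define V where "V = strictly_proper_space (dim_col F)"
  define K where "K = strictly_proper_kernel F"
  have V: "module class_ring V" unfolding V_def by (rule strictly_proper_space_module)
  have K: "submodule class_ring K V" unfolding V_def K_def by (rule strictly_proper_kernel_submodule)
  interpret Q: Module.module class_ring "quotient_space V K" by (rule quotient_space_module[OF V K])
  have V_simps: "carrier V = sp (dim_col F)" "\<zero>\<^bsub>V\<^esub> = 0\<^sub>v (dim_col F)" "x \<oplus>\<^bsub>V\<^esub> y = x + y" "c \<odot>\<^bsub>V\<^esub> x =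
      rat_const c \<cdot>\<^sub>v x" for x y c
    by (simp_all add: V_def strictly_proper_space_def)
  define cl where "cl v = K +>\<^bsub>V\<^esub> v" for v
  have cl_carrier: "cl ` X \<subseteq> carrier (quotient_space V K)" if "X \<subseteq> sp (dim_col F)" for X
    using that by (auto simp: cl_def quotient_space_def A_RCOSETS_def' V_simps)
  define S where "S = Q.span (cl ` set (cols M2))"
  have S: "submodule class_ring S (quotient_space V K)"
    unfolding S_def by (rule Q.span_is_submodule[OF cl_carrier[OF M2]])
  define T where "T = {v \<in> sp (dim_col F). cl v \<in> S}"
  have add: "v + w \<in> T" if "v \<in> T" "w \<in> T" for v w
  proof -
    have "cl (v + w) = cl v \<oplus>\<^bsub>quotient_space V K\<^esub> cl w"
      using quotient_space_add_coset[OF V K, of v w] that by (simp add: cl_def T_def V_simps)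
    then show ?thesis using that submodule.m_closed[OF S] by (simp add: T_def strictly_proper_tuples_add)
  qed
  have smult: "rat_const c \<cdot>\<^sub>v v \<in> T" if "v \<in> T" for c v
  proof -
    have "cl (rat_const c \<cdot>\<^sub>v v) = c \<odot>\<^bsub>quotient_space V K\<^esub> cl v"
      using quotient_space_smult_coset[OF V K, of c v] that by (simp add: cl_def T_def V_simps)
    then show ?thesis using that submodule.smult_closed[OF S]
      by (simp add: T_def strictly_proper_tuples_smult)
  qed
  have zero: "0\<^sub>v (dim_col F) \<in> T"
  proof -
    interpret V: Module.module class_ring V by (rule V)
    have "cl \<zero>\<^bsub>V\<^esub> = \<zero>\<^bsub>quotient_space V K\<^esub>"
      using V.a_coset_add_zero[of K] submodule.subset[OF K] by (simp add: cl_def quotient_space_def)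
    then have "cl (0\<^sub>v (dim_col F)) \<in> S" using submodule.zero_closed[OF S] by (simp add: V_simps)
    then show ?thesis by (simp add: T_def strictly_proper_tuples_zero)
  qed
  have col2: "v \<in> T" if "v \<in> set (cols M2)" for v
    using that M2 Q.in_own_span[OF cl_carrier[OF M2]] by (auto simp: T_def S_def)
  have "cl ` set (cols M1) \<subseteq> S"
  proof
    fix X assume "X \<in> cl ` set (cols M1)"
    then obtain g where g: "g \<in> set (cols M1)" "X = cl g" by blast
    obtain t where t: "t \<in> carrier_vec (dim_col M2)" and gK: "g - M2 *\<^sub>v const_vec t \<in> K"
      using rep[OF g(1)] unfolding K_def by blast
    have "M2 *\<^sub>v const_vec t \<in> T"
    proof (rule mult_mat_vec_in_closed_set[OF _ _ zero add])
      show "M2 \<in> carrier_mat (dim_col F) (dim_col M2)" using dim by auto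
      show "const_vec t $ j \<cdot>\<^sub>v col M2 j \<in> T" if "j < dim_col M2" for j
        using smult[OF col2[of "col M2 j"], of "t $ j"] that t by (simp add: cols_def)
    qed (use t in simp_all)
    moreover from this have "cl g = cl (M2 *\<^sub>v const_vec t)"
    proof -
      assume T: "M2 *\<^sub>v const_vec t \<in> T"
      have "g \<in> sp (dim_col F)" using g M1 by blast
      then have "g = (g - M2 *\<^sub>v const_vec t) + M2 *\<^sub>v const_vec t"
        using strictly_proper_tuples_carrier[of g "dim_col F"] dim
        by (auto simp: vec_eq_iff simp del: index_mult_mat_vec)
      then show ?thesis
        using coset_add_submodule_element[OF V K gK, of "M2 *\<^sub>v const_vec t"] T
        by (simp add: cl_def V_simps T_def)
    qed
    ultimately show "X \<in> S" using g(2) by (simp add: T_def)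
  qed
  then have "Q.span (cl ` set (cols M1)) \<subseteq> S" by (rule Q.span_is_subset[OF _ S])
  then show ?thesis
    unfolding generated_classes_def Let_def S_def V_def[symmetric] K_def[symmetric] cl_def[abs_def] .
qed

section \<open>Free response and observability\<close>

locale linear_system =
  fixes A B C D :: "complex mat" and n p q :: nat
  assumes A: "A \<in> carrier_mat n n" and B: "B \<in> carrier_mat n q"
    and C: "C \<in> carrier_mat p n" and D: "D \<in> carrier_mat p q"
begin

lemmas const_carriers = A[THEN const_mat_carrier] B[THEN const_mat_carrier]
  C[THEN const_mat_carrier] D[THEN const_mat_carrier]

lemmas resolvent_carrier = resolvent_inverse(1)[OF A]

abbreviation F :: "ratfun mat" where "F \<equiv> transfer_function A B C D"

lemma F_carrier: "F \<in> carrier_mat p q"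
  unfolding transfer_function_def using const_carriers resolvent_carrier by simp

lemma F_mult:
  assumes "g \<in> carrier_vec q"
  shows "F *\<^sub>v g = const_mat D *\<^sub>v g + const_mat C *\<^sub>v (resolvent A *\<^sub>v (const_mat B *\<^sub>v g))"
  unfolding transfer_function_def
  using assms const_carriers resolvent_carrier
  by (simp add: add_mult_distrib_mat_vec[of _ p q] assoc_mult_mat_vec[of _ p n _ q]
      assoc_mult_mat_vec[of _ p n _ n])

abbreviation (input) free_response :: "complex vec \<Rightarrow> ratfun vec" where
  "free_response v \<equiv> const_mat C *\<^sub>v (resolvent A *\<^sub>v const_vec v)"

text \<open>The free response \<open>C(zI - A)\<inverse>v\<close> is strictly proper, so it is zero as soon as it is polynomial.
  With \<open>x = (zI - A)\<inverse>v\<close> one has \<open>A x = (zI - A)\<inverse>A v\<close>, and \<open>0 = z C x = C A x + C v\<close> splits into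
  \<open>C v = 0\<close> and \<open>C(zI - A)\<inverse>A v = 0\<close>. The argument can be repeated for \<open>A v\<close>, so \<open>C A\<^sup>i v = 0\<close> for
  all \<open>i\<close>.\<close>
lemma free_response_poly_imp_zero:
  assumes obs: "observable C A" and v: "v \<in> carrier_vec n"
    and poly: "free_response v \<in> poly_tuples p"
  shows "v = 0\<^sub>v n"
proof -
  have sp_y: "free_response v \<in> sp p" if "v \<in> carrier_vec n" for v
    using strictly_proper_tuples_mult[OF C] resolvent_const_strictly_proper[OF A that] by blast
  have step: "C *\<^sub>v v = 0\<^sub>v p \<and> free_response (A *\<^sub>v v) = 0\<^sub>v p" if v: "v \<in> carrier_vec n"
    and y0: "free_response v = 0\<^sub>v p" for v
  proof -
    define x where "x = resolvent A *\<^sub>v const_vec v"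
    have x: "x \<in> carrier_vec n" using resolvent_closed[OF A] v by (simp add: x_def)
    have Ax: "const_mat A *\<^sub>v x \<in> carrier_vec n" using const_carriers(1) x by simp
    have zx: "indet \<cdot>\<^sub>v x = const_mat A *\<^sub>v x + const_vec v"
      using resolvent_eq_iff[OF A x, of "const_vec v"] v by (simp add: x_def)
    have "const_vec (A *\<^sub>v v) = const_mat A *\<^sub>v const_vec v"
      by (rule rat_const_hom.mult_mat_vec_hom[OF A v])
    then have "indet \<cdot>\<^sub>v (const_mat A *\<^sub>v x) = const_mat A *\<^sub>v (const_mat A *\<^sub>v x) + const_vec (A *\<^sub>v v)"
      using mult_mat_vec[OF const_carriers(1) x, of indet] v Ax
      by (simp add: zx mult_add_distrib_mat_vec[OF const_carriers(1)])
    then have RA: "const_mat A *\<^sub>v x = resolvent A *\<^sub>v const_vec (A *\<^sub>v v)"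
      using resolvent_eq_iff[OF A Ax, of "const_vec (A *\<^sub>v v)"] A v by simp
    have "0\<^sub>v p = indet \<cdot>\<^sub>v (const_mat C *\<^sub>v x)"
      unfolding x_def y0 by (intro eq_vecI) auto
    also have "\<dots> = const_mat C *\<^sub>v (const_mat A *\<^sub>v x + const_vec v)"
      using mult_mat_vec[OF const_carriers(3) x, of indet] zx by simp
    also have "\<dots> = free_response (A *\<^sub>v v) + const_vec (C *\<^sub>v v)"
      using mult_add_distrib_mat_vec[OF const_carriers(3) Ax, of "const_vec v"] v
      by (simp add: RA rat_const_hom.mult_mat_vec_hom[OF C v])
    also have "\<dots> = const_vec (C *\<^sub>v v) + free_response (A *\<^sub>v v)"
      using C v A const_carriers resolvent_carrier by (intro comm_add_vec[of _ p]) auto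
    finally have eq: "const_vec (C *\<^sub>v v) + free_response (A *\<^sub>v v) = 0\<^sub>v p + 0\<^sub>v p"
      by (metis right_zero_vec zero_carrier_vec)
    have "C *\<^sub>v v \<in> carrier_vec p" "A *\<^sub>v v \<in> carrier_vec n" using C A v by auto
    note * = const_vec_poly[OF this(1)] poly_tuples_zero sp_y[OF this(2)] strictly_proper_tuples_zero eq
    show ?thesis using poly_strictly_proper_unique[OF *] by simp
  qed
  have iter: "free_response v = 0\<^sub>v p \<Longrightarrow> C *\<^sub>v (A ^\<^sub>m i *\<^sub>v v) = 0\<^sub>v p" if "v \<in> carrier_vec n" for i v
    using that
  proof (induction i arbitrary: v)
    case 0
    then show ?case using step A by simp
  next
    case (Suc i)
    have "A ^\<^sub>m Suc i *\<^sub>v v = A ^\<^sub>m i *\<^sub>v (A *\<^sub>v v)"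
      using assoc_mult_mat_vec[OF pow_carrier_mat[OF A] A Suc.prems(2)] by simp
    then show ?case using Suc step A by simp
  qed
  have "free_response v = 0\<^sub>v p" using poly_strictly_proper_zero[OF poly sp_y[OF v]] .
  then have "v \<in> mat_kernel (C * A ^\<^sub>m i)" for i
    using iter[OF v] v C A pow_carrier_mat[OF A, of i]
      assoc_mult_mat_vec[OF C pow_carrier_mat[OF A] v, of i]
    by (simp add: mat_kernel[of _ p n])
  then show ?thesis using obs A unfolding observable_def by auto
qed

section \<open>Reachable space and polynomial inputs\<close>

text \<open>The powers of \<open>A\<close> in the definition are traded for a characterization: \<open>\<langle>A | B\<rangle>\<close> is the least
  subspace that contains the image of \<open>B\<close> and is stable under \<open>A\<close>.\<close>
lemma reachable_space_facts:
  shows reachable_carrier: "reachable_space A B \<subseteq> carrier_vec n"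
    and reachable_zero: "0\<^sub>v n \<in> reachable_space A B"
    and reachable_add: "\<And>v w. v \<in> reachable_space A B \<Longrightarrow> w \<in> reachable_space A B \<Longrightarrow>
      v + w \<in> reachable_space A B"
    and reachable_smult: "\<And>c v. v \<in> reachable_space A B \<Longrightarrow> c \<cdot>\<^sub>v v \<in> reachable_space A B"
    and reachable_A: "\<And>v. v \<in> reachable_space A B \<Longrightarrow> A *\<^sub>v v \<in> reachable_space A B"
    and reachable_B: "\<And>v. v \<in> carrier_vec q \<Longrightarrow> B *\<^sub>v v \<in> reachable_space A B"
    and reachable_least: "\<And>S. \<lbrakk>S \<subseteq> carrier_vec n; 0\<^sub>v n \<in> S; \<And>v w. v \<in> S \<Longrightarrow> w \<in> S \<Longrightarrow> v + w \<in> S;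
      \<And>c v. v \<in> S \<Longrightarrow> c \<cdot>\<^sub>v v \<in> S; \<And>v. v \<in> S \<Longrightarrow> A *\<^sub>v v \<in> S; \<And>v. v \<in> carrier_vec q \<Longrightarrow> B *\<^sub>v v \<in> S\<rbrakk>
      \<Longrightarrow> reachable_space A B \<subseteq> S"
proof -
  interpret V: vec_space "TYPE(complex)" n .
  define G where "G = (\<Union>i. set (cols (A ^\<^sub>m i * B)))"
  have R: "reachable_space A B = V.span G"
    using A by (simp add: reachable_space_def G_def)
  have G: "G \<subseteq> carrier_vec n"
    using A B pow_carrier_mat[OF A] cols_dim[of "A ^\<^sub>m _ * B"] by (fastforce simp: G_def)
  have submoduleI: "submodule class_ring S V.V"
    if "S \<subseteq> carrier_vec n" "0\<^sub>v n \<in> S" "\<And>v w. v \<in> S \<Longrightarrow> w \<in> S \<Longrightarrow> v + w \<in> S"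
      "\<And>c v. v \<in> S \<Longrightarrow> c \<cdot>\<^sub>v v \<in> S" for S
    using that by (intro submodule.intro vec_module) (auto simp: module_vec_simps)
  have G_iff: "v \<in> G \<longleftrightarrow> (\<exists>i. \<exists>j<q. v = A ^\<^sub>m i *\<^sub>v (B *\<^sub>v unit_vec q j))" for v
  proof -
    have "col (A ^\<^sub>m i * B) j = A ^\<^sub>m i *\<^sub>v (B *\<^sub>v unit_vec q j)" if "j < q" for i j
    proof -
      have "B *\<^sub>v unit_vec q j = col B j" using that B by (intro eq_vecI) auto
      then show ?thesis using that col_mult2[OF pow_carrier_mat[OF A] B] by simp
    qed
    moreover have "set (cols (A ^\<^sub>m i * B)) = {col (A ^\<^sub>m i * B) j | j. j < q}" for i
      using B by (auto simp: cols_def)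
    then have "v \<in> G \<longleftrightarrow> (\<exists>i. \<exists>j<q. v = col (A ^\<^sub>m i * B) j)"
      unfolding G_def by blast
    ultimately show ?thesis by (simp cong: conj_cong)
  qed
  show add: "v + w \<in> reachable_space A B" if "v \<in> reachable_space A B" "w \<in> reachable_space A B" for v w
    using V.span_add1[OF G] that by (simp add: R)
  show smult: "c \<cdot>\<^sub>v v \<in> reachable_space A B" if "v \<in> reachable_space A B" for c v
    using V.smult_in_span[OF G] that by (simp add: R)
  show car: "reachable_space A B \<subseteq> carrier_vec n" using V.span_is_subset2[OF G] by (simp add: R)
  show zero: "0\<^sub>v n \<in> reachable_space A B"
    using V.span_zero by (simp add: R)
  show "B *\<^sub>v v \<in> reachable_space A B" if "v \<in> carrier_vec q" for v
  proof -
    have "B *\<^sub>v v \<in> V.col_space B" using that B by (auto simp: V.col_space_eq[OF B])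
    moreover have "set (cols B) \<subseteq> G" using A B by (auto simp: G_def intro!: exI[of _ "0::nat"])
    ultimately show ?thesis
      using subsetD[OF V.span_is_monotone[of "set (cols B)" G]] unfolding R V.col_space_def by blast
  qed
  have least: "reachable_space A B \<subseteq> S"
    if "S \<subseteq> carrier_vec n" "0\<^sub>v n \<in> S" "\<And>v w. v \<in> S \<Longrightarrow> w \<in> S \<Longrightarrow> v + w \<in> S"
      "\<And>c v. v \<in> S \<Longrightarrow> c \<cdot>\<^sub>v v \<in> S" "G \<subseteq> S" for S
    unfolding R by (rule V.span_is_subset[OF that(5) submoduleI[OF that(1-4)]])
  have A0: "A *\<^sub>v 0\<^sub>v n = 0\<^sub>v n" using A by (intro eq_vecI) auto
  have "reachable_space A B \<subseteq> {v \<in> carrier_vec n. A *\<^sub>v v \<in> reachable_space A B}"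
  proof (rule least)
    show "G \<subseteq> {v \<in> carrier_vec n. A *\<^sub>v v \<in> reachable_space A B}"
    proof
      fix v assume "v \<in> G"
      then obtain i j where ij: "j < q" "v = A ^\<^sub>m i *\<^sub>v (B *\<^sub>v unit_vec q j)" by (auto simp: G_iff)
      have Ai: "A ^\<^sub>m i \<in> carrier_mat n n" using A by simp
      have "A * A ^\<^sub>m i = A ^\<^sub>m i * A"
        using Ai A by (induction i) (auto simp: assoc_mult_mat[of _ n n _ n _ n, symmetric]
            pow_carrier_mat[OF A])
      then have "A *\<^sub>v v = A ^\<^sub>m Suc i *\<^sub>v (B *\<^sub>v unit_vec q j)"
        using ij(2) B assoc_mult_mat_vec[OF A Ai, of "B *\<^sub>v unit_vec q j"] by simp
      then have "A *\<^sub>v v \<in> G" using ij(1) unfolding G_iff by blast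
      then show "v \<in> {v \<in> carrier_vec n. A *\<^sub>v v \<in> reachable_space A B}"
        using \<open>v \<in> G\<close> G V.in_own_span[OF G] by (auto simp: R)
    qed
  qed (use A zero A0 in \<open>auto simp: add smult mult_add_distrib_mat_vec[OF A] mult_mat_vec[OF A]\<close>)
  then show "A *\<^sub>v v \<in> reachable_space A B" if "v \<in> reachable_space A B" for v using that by blast
  show "reachable_space A B \<subseteq> S"
    if S: "S \<subseteq> carrier_vec n" "0\<^sub>v n \<in> S" "\<And>v w. v \<in> S \<Longrightarrow> w \<in> S \<Longrightarrow> v + w \<in> S"
      "\<And>c v. v \<in> S \<Longrightarrow> c \<cdot>\<^sub>v v \<in> S" and SA: "\<And>v. v \<in> S \<Longrightarrow> A *\<^sub>v v \<in> S"
      and SB: "\<And>v. v \<in> carrier_vec q \<Longrightarrow> B *\<^sub>v v \<in> S" for S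
  proof (rule least[OF S])
    have "v \<in> S \<Longrightarrow> A ^\<^sub>m i *\<^sub>v v \<in> S" for i v
    proof (induction i arbitrary: v)
      case 0
      then show ?case using S(1) A by auto
    next
      case (Suc i)
      then show ?case
        using assoc_mult_mat_vec[OF pow_carrier_mat[OF A] A, of v i] S(1) SA by auto
    qed
    then show "G \<subseteq> S" using SB by (auto simp: G_iff)
  qed
qed

text \<open>For polynomial \<open>u\<close> and \<open>y\<close>, the equation on the right is one between polynomial tuples.\<close>
lemma polynomial_response_iff:
  assumes y: "y \<in> carrier_vec n" and u: "u \<in> carrier_vec q" and w: "w \<in> carrier_vec n"
  shows "resolvent A *\<^sub>v (const_mat B *\<^sub>v u) = y + resolvent A *\<^sub>v const_vec w \<longleftrightarrow>
    const_mat B *\<^sub>v u + const_mat A *\<^sub>v y = indet \<cdot>\<^sub>v y + const_vec w"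
proof -
  define s where "s = resolvent A *\<^sub>v const_vec w"
  have s: "s \<in> carrier_vec n" using resolvent_closed[OF A] w by (simp add: s_def)
  have zs: "indet \<cdot>\<^sub>v s = const_mat A *\<^sub>v s + const_vec w"
    using resolvent_eq_iff[OF A s, of "const_vec w"] w by (simp add: s_def)
  have Bu: "const_mat B *\<^sub>v u \<in> carrier_vec n" using B u by simp
  have "y + s = resolvent A *\<^sub>v (const_mat B *\<^sub>v u) \<longleftrightarrow>
      indet \<cdot>\<^sub>v (y + s) = const_mat A *\<^sub>v (y + s) + const_mat B *\<^sub>v u"
    using resolvent_eq_iff[OF A _ Bu, of "y + s"] y s by simp
  also have "\<dots> \<longleftrightarrow> indet \<cdot>\<^sub>v y + (const_mat A *\<^sub>v s + const_vec w) =
      const_mat A *\<^sub>v y + const_mat A *\<^sub>v s + const_mat B *\<^sub>v u"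
    using y s by (simp add: smult_add_distrib_vec[OF y s]
        mult_add_distrib_mat_vec[OF const_carriers(1) y s] zs)
  also have "\<dots> \<longleftrightarrow> const_mat B *\<^sub>v u + const_mat A *\<^sub>v y = indet \<cdot>\<^sub>v y + const_vec w"
    using y[THEN carrier_vecD] s[THEN carrier_vecD]
        w[THEN carrier_vecD] A[THEN carrier_matD(1)] B[THEN carrier_matD(1)]
    unfolding vec_eq_iff by (auto simp: algebra_simps simp del: index_mult_mat_vec)
  finally show ?thesis by (auto simp: s_def)
qed

text \<open>The vectors \<open>w\<close> for which \<open>B u + A y = z y + w\<close> has a polynomial solution \<open>(u, y)\<close> form a
  subspace. It contains \<open>B v\<close>, with the solution \<open>(v, 0)\<close>, and it is stable under \<open>A\<close>, because
  \<open>(z u, z y + w)\<close> is a solution for \<open>A w\<close>; so it contains the reachable space. The other inclusion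
  is the coefficient recursion.\<close>
lemma reachable_iff_polynomial_input:
  "w \<in> reachable_space A B \<longleftrightarrow> w \<in> carrier_vec n \<and>
     (\<exists>u \<in> poly_tuples q. \<exists>y \<in> poly_tuples n.
        resolvent A *\<^sub>v (const_mat B *\<^sub>v u) = y + resolvent A *\<^sub>v const_vec w)"
proof -
  define S where "S = {w \<in> carrier_vec n. \<exists>u \<in> poly_tuples q. \<exists>y \<in> poly_tuples n.
    const_mat B *\<^sub>v u + const_mat A *\<^sub>v y = indet \<cdot>\<^sub>v y + const_vec w}"
  have "S = reachable_space A B"
  proof
    show "S \<subseteq> reachable_space A B"
    proof
      fix w assume "w \<in> S"
      then obtain U Y where w: "w \<in> carrier_vec n" and U: "U \<in> carrier_vec q" and Y: "Y \<in> carrier_vec n"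
        and eq: "const_mat B *\<^sub>v map_vec to_fract U + const_mat A *\<^sub>v map_vec to_fract Y =
          indet \<cdot>\<^sub>v map_vec to_fract Y + const_vec w"
        unfolding S_def poly_tuples_def by blast
      from U show "w \<in> reachable_space A B"
        by (intro poly_state_coefficients(2)[OF A B U Y w eq reachable_zero] reachable_add reachable_A reachable_B) auto
    qed
    show "reachable_space A B \<subseteq> S"
    proof (rule reachable_least)
      show "0\<^sub>v n \<in> S" unfolding S_def
        using const_carriers
        by (intro CollectI conjI bexI[OF _ poly_tuples_zero]) (auto simp: vec_eq_iff)
      show "v + w \<in> S" if "v \<in> S" "w \<in> S" for v w
      proof -
        from that obtain u y u' y' where *: "u \<in> poly_tuples q" "y \<in> poly_tuples n" "u' \<in>
            poly_tuples q" "y' \<in> poly_tuples n"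
          and vw: "v \<in> carrier_vec n" "w \<in> carrier_vec n"
          and eq: "const_mat B *\<^sub>v u + const_mat A *\<^sub>v y = indet \<cdot>\<^sub>v y + const_vec v"
            "const_mat B *\<^sub>v u' + const_mat A *\<^sub>v y' = indet \<cdot>\<^sub>v y' + const_vec w"
          unfolding S_def by blast
        note c = *[THEN poly_tuples_carrier]
        have "const_mat B *\<^sub>v (u + u') + const_mat A *\<^sub>v (y + y') =
          (const_mat B *\<^sub>v u + const_mat A *\<^sub>v y) + (const_mat B *\<^sub>v u' + const_mat A *\<^sub>v y')"
          unfolding mult_add_distrib_mat_vec[OF const_carriers(1) c(2,4)]
              mult_add_distrib_mat_vec[OF const_carriers(2) c(1,3)]
          using A B by (auto simp: vec_eq_iff algebra_simps simp del: index_mult_mat_vec)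
        also have "\<dots> = indet \<cdot>\<^sub>v (y + y') + const_vec (v + w)"
          unfolding eq using c vw by (auto simp: vec_eq_iff algebra_simps rat_const_hom.hom_add)
        finally show ?thesis unfolding S_def
          using vw poly_tuples_add[OF *(1,3)] poly_tuples_add[OF *(2,4)] by auto
      qed
      show "c \<cdot>\<^sub>v v \<in> S" if "v \<in> S" for c v
      proof -
        from that obtain u y where *: "u \<in> poly_tuples q" "y \<in> poly_tuples n"
          and v: "v \<in> carrier_vec n"
          and eq: "const_mat B *\<^sub>v u + const_mat A *\<^sub>v y = indet \<cdot>\<^sub>v y + const_vec v"
          unfolding S_def by blast
        note c = *[THEN poly_tuples_carrier]
        have "const_mat B *\<^sub>v (rat_const c \<cdot>\<^sub>v u) + const_mat A *\<^sub>v (rat_const c \<cdot>\<^sub>v y) =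
          rat_const c \<cdot>\<^sub>v (const_mat B *\<^sub>v u + const_mat A *\<^sub>v y)"
          unfolding mult_mat_vec[OF const_carriers(1) c(2)] mult_mat_vec[OF const_carriers(2) c(1)]
          using A B by (auto simp: vec_eq_iff algebra_simps simp del: index_mult_mat_vec)
        also have "\<dots> = indet \<cdot>\<^sub>v (rat_const c \<cdot>\<^sub>v y) + const_vec (c \<cdot>\<^sub>v v)"
          unfolding eq using c v by (auto simp: vec_eq_iff algebra_simps rat_const_hom.hom_mult)
        finally show ?thesis unfolding S_def
          using v poly_tuples_smult[OF *(1), of "[:c:]"] poly_tuples_smult[OF *(2), of "[:c:]"]
          by (auto simp flip: rat_const_def)
      qed
      show "A *\<^sub>v v \<in> S" if "v \<in> S" for v
      proof -
        from that obtain u y where *: "u \<in> poly_tuples q" "y \<in> poly_tuples n"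
          and v: "v \<in> carrier_vec n"
          and eq: "const_mat B *\<^sub>v u + const_mat A *\<^sub>v y = indet \<cdot>\<^sub>v y + const_vec v"
          unfolding S_def by blast
        note c = *[THEN poly_tuples_carrier]
        have "const_mat B *\<^sub>v (indet \<cdot>\<^sub>v u) + const_mat A *\<^sub>v (indet \<cdot>\<^sub>v y + const_vec v) =
          indet \<cdot>\<^sub>v (const_mat B *\<^sub>v u + const_mat A *\<^sub>v y) + const_mat A *\<^sub>v const_vec v"
          using mult_mat_vec[OF const_carriers(1) c(2), of indet]
              mult_mat_vec[OF const_carriers(2) c(1), of indet]
            mult_add_distrib_mat_vec[OF const_carriers(1), of "indet \<cdot>\<^sub>v y" "const_vec v"] c v A B
          by (auto simp: vec_eq_iff algebra_simps simp del: index_mult_mat_vec)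
        also have "\<dots> = indet \<cdot>\<^sub>v (indet \<cdot>\<^sub>v y + const_vec v) + const_vec (A *\<^sub>v v)"
          unfolding eq rat_const_hom.mult_mat_vec_hom[OF A v] ..
        finally show ?thesis unfolding S_def
          using A v poly_tuples_smult[OF *(1), of "[:0, 1:]"]
            poly_tuples_add[OF poly_tuples_smult[OF *(2), of "[:0, 1:]"] const_vec_poly[OF v]]
          by (auto simp flip: indet_def)
      qed
      show "B *\<^sub>v v \<in> S" if "v \<in> carrier_vec q" for v
      proof -
        have "const_mat B *\<^sub>v const_vec v + const_mat A *\<^sub>v 0\<^sub>v n = indet \<cdot>\<^sub>v 0\<^sub>v n + const_vec (B *\<^sub>v v)"
          unfolding rat_const_hom.mult_mat_vec_hom[OF B that] using A B by (auto simp: vec_eq_iff)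
        then show ?thesis unfolding S_def
          using B that const_vec_poly[OF that] poly_tuples_zero by fastforce
      qed
    qed (auto simp: S_def)
  qed
  then show ?thesis
    using polynomial_response_iff poly_tuples_carrier unfolding S_def by blast
qed

text \<open>The strictly proper part \<open>t\<close> of the state caused by a polynomial input satisfies
  \<open>z t = A t + c\<close> with a constant \<open>c\<close>: after the input has stopped, the system moves freely from the
  state it was brought to.\<close>
lemma polynomial_input_response:
  assumes u: "u \<in> poly_tuples q"
  obtains w y where "w \<in> reachable_space A B" "y \<in> poly_tuples n"
    "resolvent A *\<^sub>v (const_mat B *\<^sub>v u) = y + resolvent A *\<^sub>v const_vec w"
proof -
  define x where "x = resolvent A *\<^sub>v (const_mat B *\<^sub>v u)"
  have Bu: "const_mat B *\<^sub>v u \<in> poly_tuples n" by (rule poly_tuples_mult[OF B u])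
  have x: "x \<in> carrier_vec n" unfolding x_def by (rule resolvent_closed[OF A poly_tuples_carrier[OF Bu]])
  obtain y t where y: "y \<in> poly_tuples n" and t: "t \<in> sp n" and xyt: "x = y + t"
    using tuple_decompose[OF x] .
  obtain c t' where c: "c \<in> carrier_vec n" and t': "t' \<in> sp n" and zt: "indet \<cdot>\<^sub>v t = const_vec c + t'"
    using tuple_shift[OF t] .
  note yc = poly_tuples_carrier[OF y] and tc = strictly_proper_tuples_carrier[OF t]
    and tc' = strictly_proper_tuples_carrier[OF t']
  have "indet \<cdot>\<^sub>v x = const_mat A *\<^sub>v x + const_mat B *\<^sub>v u"
    using resolvent_eq_iff[OF A x poly_tuples_carrier[OF Bu]] by (simp add: x_def)
  then have "indet \<cdot>\<^sub>v y + (const_vec c + t') = (const_mat A *\<^sub>v y + const_mat A *\<^sub>v t) + const_mat B *\<^sub>v u"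
    by (simp add: xyt mult_add_distrib_mat_vec[OF const_carriers(1) yc tc]
        smult_add_distrib_vec[OF yc tc] zt)
  then have eq: "(indet \<cdot>\<^sub>v y + const_vec c) + t' =
      (const_mat A *\<^sub>v y + const_mat B *\<^sub>v u) + const_mat A *\<^sub>v t"
    using yc tc tc' A B c by (auto simp: vec_eq_iff algebra_simps simp del: index_mult_mat_vec)
  have t'_eq: "t' = const_mat A *\<^sub>v t"
    by (rule poly_strictly_proper_unique(2)[OF _ _ t' strictly_proper_tuples_mult[OF A t] eq])
      (auto intro!: poly_tuples_add poly_tuples_mult[OF A] const_vec_poly c y Bu simp: indet_def
          poly_tuples_smult[OF y])
  have "indet \<cdot>\<^sub>v t = const_mat A *\<^sub>v t + const_vec c"
    unfolding zt t'_eq using tc c A by (intro comm_add_vec[of _ n]) auto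
  then have "t = resolvent A *\<^sub>v const_vec c"
    using resolvent_eq_iff[OF A tc, of "const_vec c"] c by simp
  then have R: "resolvent A *\<^sub>v (const_mat B *\<^sub>v u) = y + resolvent A *\<^sub>v const_vec c"
    using xyt by (simp add: x_def)
  have "c \<in> reachable_space A B" unfolding reachable_iff_polynomial_input using c u y R by blast
  then show ?thesis using that y R by blast
qed

section \<open>Responses of solution triples\<close>

lemma zero_triple_iff:
  "zero_triple A B C D P H L \<longleftrightarrow>
     (\<exists>k. P \<in> carrier_mat n k \<and> H \<in> carrier_mat q k \<and> L \<in> carrier_mat k k \<and>
          A * P + B * H = P * L \<and> C * P + D * H = 0\<^sub>m p k)"
proof -
  have "four_block_mat A B C D * (P @\<^sub>r H) = (P * L) @\<^sub>r 0\<^sub>m p k \<longleftrightarrow>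
      A * P + B * H = P * L \<and> C * P + D * H = 0\<^sub>m p k"
    if P: "P \<in> carrier_mat n k" and H: "H \<in> carrier_mat q k" and L: "L \<in> carrier_mat k k" for k
  proof -
    have "four_block_mat A B C D * (P @\<^sub>r H) = (A * P + B * H) @\<^sub>r (C * P + D * H)"
    proof -
      have "four_block_mat A B C D * four_block_mat P (0\<^sub>m n 0) H (0\<^sub>m q 0) =
          four_block_mat (A * P + B * H) (A * 0\<^sub>m n 0 + B * 0\<^sub>m q 0) (C * P + D * H) (C * 0\<^sub>m n 0 + D * 0\<^sub>m q 0)"
        by (rule mult_four_block_mat[OF A B C D P _ H]) auto
      moreover have "A * 0\<^sub>m n 0 + B * 0\<^sub>m q 0 = 0\<^sub>m n 0" "C * 0\<^sub>m n 0 + D * 0\<^sub>m q 0 = 0\<^sub>m p 0"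
        using A B C D by auto
      ultimately show ?thesis using A B C D P H by (simp add: append_rows_def)
    qed
    then show ?thesis
      using A B C D P H L append_rows_eq_iff[of "A * P + B * H" n k "P * L" "C * P + D * H" p "0\<^sub>m p k"]
      by simp
  qed
  then show ?thesis using A B C unfolding zero_triple_def by auto
qed

lemma state_space_output:
  assumes x: "x \<in> carrier_vec n" and g: "g \<in> carrier_vec q" and v: "v \<in> carrier_vec n"
    and eq: "indet \<cdot>\<^sub>v x = const_mat A *\<^sub>v x + (const_mat B *\<^sub>v g + const_vec v)"
  shows "F *\<^sub>v g + free_response v = const_mat C *\<^sub>v x + const_mat D *\<^sub>v g"
proof -
  have Bg: "const_mat B *\<^sub>v g \<in> carrier_vec n" using B g by simp
  have R: "resolvent A *\<^sub>v w \<in> carrier_vec n" if "w \<in> carrier_vec n" for w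
    by (rule resolvent_closed[OF A that])
  have "x = resolvent A *\<^sub>v (const_mat B *\<^sub>v g + const_vec v)"
    using resolvent_eq_iff[OF A x, of "const_mat B *\<^sub>v g + const_vec v"] eq Bg v by simp
  then have "x = resolvent A *\<^sub>v (const_mat B *\<^sub>v g) + resolvent A *\<^sub>v const_vec v"
    using mult_add_distrib_mat_vec[OF resolvent_carrier Bg, of "const_vec v"] v by simp
  then have Cx: "const_mat C *\<^sub>v x = const_mat C *\<^sub>v (resolvent A *\<^sub>v (const_mat B *\<^sub>v g)) +
      free_response v"
    using mult_add_distrib_mat_vec[OF const_carriers(3) R[OF Bg] R, of "const_vec v"] v by simp
  show ?thesis unfolding F_mult[OF g] Cx using C D
    by (auto simp: vec_eq_iff algebra_simps simp del: index_mult_mat_vec)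
qed

text \<open>With \<open>t = (zI - \<Lambda>)\<inverse>G\<close>, the relation \<open>\<Pi>\<Lambda> = A\<Pi> + BH\<close> says that \<open>\<Pi>t\<close> is the state for the
  input \<open>Ht\<close> and the initial state \<open>\<Pi>G\<close>. Its output \<open>(C\<Pi> + DH)t\<close> is zero.\<close>
lemma zero_triple_response:
  assumes P: "P \<in> carrier_mat n k" and H: "H \<in> carrier_mat q k" and L: "L \<in> carrier_mat k k"
    and eqs: "A * P + B * H = P * L" "C * P + D * H = 0\<^sub>m p k" and G: "G \<in> carrier_vec k"
  shows "(const_mat H * resolvent L) *\<^sub>v const_vec G \<in> sp q"
    and "F *\<^sub>v ((const_mat H * resolvent L) *\<^sub>v const_vec G) +
      free_response (P *\<^sub>v G) = 0\<^sub>v p"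
proof -
  define t where "t = resolvent L *\<^sub>v const_vec G"
  have tsp: "t \<in> sp k" unfolding t_def by (rule resolvent_const_strictly_proper[OF L G])
  then have t: "t \<in> carrier_vec k" by (rule strictly_proper_tuples_carrier)
  have HR: "(const_mat H * resolvent L) *\<^sub>v const_vec G = const_mat H *\<^sub>v t"
    unfolding t_def using assoc_mult_mat_vec[OF const_mat_carrier[OF H] resolvent_inverse(1)[OF L]] G
    by simp
  show "(const_mat H * resolvent L) *\<^sub>v const_vec G \<in> sp q"
    unfolding HR by (rule strictly_proper_tuples_mult[OF H tsp])
  have zt: "indet \<cdot>\<^sub>v t = const_mat L *\<^sub>v t + const_vec G"
    using resolvent_eq_iff[OF L t, of "const_vec G"] G by (simp add: t_def)
  note cP = P[THEN const_mat_carrier] and cH = H[THEN const_mat_carrier] and cL = L[THEN const_mat_carrier]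
  have lift: "const_mat X *\<^sub>v (const_mat Y *\<^sub>v t) = const_mat (X * Y) *\<^sub>v t"
    if "X \<in> carrier_mat a b" "Y \<in> carrier_mat b k" for X Y a b
    using that t by (simp add: rat_const_hom.mat_hom_mult[OF that] assoc_mult_mat_vec[of _ a b _ k])
  have lift_add: "const_mat X *\<^sub>v t + const_mat Y *\<^sub>v t = const_mat (X + Y) *\<^sub>v t"
    if "X \<in> carrier_mat a k" "Y \<in> carrier_mat a k" for X Y a
  proof -
    have "const_mat (X + Y) = const_mat X + const_mat Y" using that
      by (intro eq_matI) (auto simp: rat_const_hom.hom_add)
    then show ?thesis using add_mult_distrib_mat_vec[OF const_mat_carrier[OF that(1)]
        const_mat_carrier[OF that(2)] t] by simp
  qed
  have Pt: "const_mat P *\<^sub>v t \<in> carrier_vec n" and Ht: "const_mat H *\<^sub>v t \<in> carrier_vec q" using cP cH t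
    by auto
  have "indet \<cdot>\<^sub>v (const_mat P *\<^sub>v t) = const_mat P *\<^sub>v (const_mat L *\<^sub>v t + const_vec G)"
    using mult_mat_vec[OF cP t, of indet] zt by simp
  also have "\<dots> = const_mat P *\<^sub>v (const_mat L *\<^sub>v t) + const_vec (P *\<^sub>v G)"
    using mult_add_distrib_mat_vec[OF cP, of "const_mat L *\<^sub>v t" "const_vec G"] cL t G
    by (simp add: rat_const_hom.mult_mat_vec_hom[OF P G])
  also have "const_mat P *\<^sub>v (const_mat L *\<^sub>v t) = const_mat (A * P + B * H) *\<^sub>v t"
    unfolding eqs(1) by (rule lift[OF P L])
  also have "\<dots> = const_mat A *\<^sub>v (const_mat P *\<^sub>v t) + const_mat B *\<^sub>v (const_mat H *\<^sub>v t)"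
    unfolding lift[OF A P] lift[OF B H] using A B P H by (intro lift_add[symmetric, of _ n]) auto
  finally have "indet \<cdot>\<^sub>v (const_mat P *\<^sub>v t) = const_mat A *\<^sub>v (const_mat P *\<^sub>v t) +
      (const_mat B *\<^sub>v (const_mat H *\<^sub>v t) + const_vec (P *\<^sub>v G))"
    using assoc_add_vec[of "const_mat A *\<^sub>v (const_mat P *\<^sub>v t)" n
        "const_mat B *\<^sub>v (const_mat H *\<^sub>v t)" "const_vec (P *\<^sub>v G)"]
      A B P G Pt Ht by simp
  from state_space_output[OF Pt Ht _ this]
  have "F *\<^sub>v (const_mat H *\<^sub>v t) + free_response (P *\<^sub>v G) =
      const_mat C *\<^sub>v (const_mat P *\<^sub>v t) + const_mat D *\<^sub>v (const_mat H *\<^sub>v t)"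
    using P G by simp
  also have "\<dots> = const_mat (C * P + D * H) *\<^sub>v t"
    unfolding lift[OF C P] lift[OF D H] using C D P H by (intro lift_add[of _ p]) auto
  also have "\<dots> = 0\<^sub>v p" unfolding eqs(2) using t by (intro eq_vecI) (auto simp: scalar_prod_def)
  finally show "F *\<^sub>v ((const_mat H * resolvent L) *\<^sub>v const_vec G) +
      free_response (P *\<^sub>v G) = 0\<^sub>v p" unfolding HR .
qed

text \<open>A polynomial summand of \<open>g\<close> contributes to \<open>F g\<close> a polynomial and the free response of a
  reachable state, and the free response of every reachable state arises in this way.\<close>
lemma poly_preimage_plus_poly_iff:
  assumes g: "g \<in> carrier_vec q"
  shows "g \<in> poly_preimage_plus_poly F \<longleftrightarrow>
    (\<exists>w \<in> reachable_space A B. F *\<^sub>v g + free_response w \<in> poly_tuples p)"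
proof -
  have dims: "dim_row F = p" "dim_col F = q" using F_carrier by auto
  have Fu: "F *\<^sub>v u = (const_mat D *\<^sub>v u + const_mat C *\<^sub>v y) + free_response w"
    "const_mat D *\<^sub>v u + const_mat C *\<^sub>v y \<in> poly_tuples p"
    if "u \<in> poly_tuples q" "y \<in> poly_tuples n" "w \<in> carrier_vec n"
      "resolvent A *\<^sub>v (const_mat B *\<^sub>v u) = y + resolvent A *\<^sub>v const_vec w" for u y w
  proof -
    note c = that(1,2)[THEN poly_tuples_carrier]
    have "resolvent A *\<^sub>v const_vec w \<in> carrier_vec n" using that(3) by (intro resolvent_closed[OF A]) simp
    then show "F *\<^sub>v u = (const_mat D *\<^sub>v u + const_mat C *\<^sub>v y) + free_response w"
      using F_mult[OF c(1)] C D mult_add_distrib_mat_vec[OF const_carriers(3) c(2), of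
          "resolvent A *\<^sub>v const_vec w"]
      unfolding that(4) by (auto simp: vec_eq_iff algebra_simps simp del: index_mult_mat_vec)
    show "const_mat D *\<^sub>v u + const_mat C *\<^sub>v y \<in> poly_tuples p"
      by (intro poly_tuples_add poly_tuples_mult[OF C] poly_tuples_mult[OF D] that)
  qed
  have C_uminus: "free_response (- w) = - free_response w"
    if "w \<in> carrier_vec n" for w
  proof -
    have "const_vec (- w) = (- 1) \<cdot>\<^sub>v const_vec w" using that
      by (intro eq_vecI) (auto simp: rat_const_hom.hom_uminus)
    then have "resolvent A *\<^sub>v const_vec (- w) = (- 1) \<cdot>\<^sub>v (resolvent A *\<^sub>v const_vec w)"
      using mult_mat_vec[OF resolvent_carrier, of "const_vec w" "- 1"] that by simp
    then have "free_response (- w) = (- 1) \<cdot>\<^sub>v free_response w"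
      using mult_mat_vec[OF const_carriers(3) resolvent_closed[OF A], of "const_vec w" "- 1"] that by simp
    also have "\<dots> = - free_response w" by (intro eq_vecI) auto
    finally show ?thesis .
  qed
  show ?thesis
  proof
    assume "g \<in> poly_preimage_plus_poly F"
    then obtain h u where h: "h \<in> carrier_vec q" "F *\<^sub>v h \<in> poly_tuples p" and u: "u \<in> poly_tuples q"
      and ghu: "g = h + u"
      unfolding poly_preimage_plus_poly_def poly_preimage_def dims by blast
    obtain w y where w: "w \<in> reachable_space A B" and y: "y \<in> poly_tuples n"
      and R: "resolvent A *\<^sub>v (const_mat B *\<^sub>v u) = y + resolvent A *\<^sub>v const_vec w"
      using polynomial_input_response[OF u] .
    have wc: "w \<in> carrier_vec n" using w reachable_carrier by blast
    have "F *\<^sub>v g = F *\<^sub>v h + F *\<^sub>v u"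
      unfolding ghu by (rule mult_add_distrib_mat_vec[OF F_carrier h(1) poly_tuples_carrier[OF u]])
    then have "F *\<^sub>v g + free_response (- w) = F *\<^sub>v h + (const_mat D *\<^sub>v u + const_mat C *\<^sub>v y)"
      unfolding C_uminus[OF wc] Fu(1)[OF u y wc R] using C D F_carrier
      by (auto simp: vec_eq_iff algebra_simps simp del: index_mult_mat_vec)
    moreover have "- w = (- 1) \<cdot>\<^sub>v w" by (intro eq_vecI) auto
    then have "- w \<in> reachable_space A B" using reachable_smult[OF w] by simp
    ultimately show "\<exists>w \<in> reachable_space A B. F *\<^sub>v g + free_response w \<in> poly_tuples p"
      using poly_tuples_add[OF h(2) Fu(2)[OF u y wc R]] by (intro bexI[of _ "- w"]) simp_all
  next
    assume "\<exists>w \<in> reachable_space A B. F *\<^sub>v g + free_response w \<in> poly_tuples p"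
    then obtain w where w: "w \<in> reachable_space A B"
      and pol: "F *\<^sub>v g + free_response w \<in> poly_tuples p" by blast
    from w obtain u y where wc: "w \<in> carrier_vec n" and u: "u \<in> poly_tuples q" and y: "y \<in> poly_tuples n"
      and R: "resolvent A *\<^sub>v (const_mat B *\<^sub>v u) = y + resolvent A *\<^sub>v const_vec w"
      unfolding reachable_iff_polynomial_input by blast
    have "F *\<^sub>v (g + u) = F *\<^sub>v g + F *\<^sub>v u"
      by (rule mult_add_distrib_mat_vec[OF F_carrier g poly_tuples_carrier[OF u]])
    also have "\<dots> = (F *\<^sub>v g + free_response w) + (const_mat D *\<^sub>v u + const_mat C *\<^sub>v y)"
      unfolding Fu(1)[OF u y wc R] using C D F_carrier
      by (auto simp: vec_eq_iff algebra_simps simp del: index_mult_mat_vec)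
    finally have "F *\<^sub>v (g + u) \<in> poly_tuples p"
      using poly_tuples_add[OF pol Fu(2)[OF u y wc R]] by simp
    then have "g + u \<in> poly_preimage F"
      using g poly_tuples_carrier[OF u] by (simp add: poly_preimage_def dims)
    moreover have "g = (g + u) + (- u)" using g poly_tuples_carrier[OF u] by (auto simp: vec_eq_iff)
    ultimately show "g \<in> poly_preimage_plus_poly F"
      unfolding poly_preimage_plus_poly_def dims using poly_tuples_uminus[OF u] by blast
  qed
qed

section \<open>Output-nulling subspaces\<close>

text \<open>The feedback matrix in the usual definition of output-nulling controlled invariant subspaces is
  replaced by a choice of an input value for each vector.\<close>
definition output_nulling :: "complex vec set \<Rightarrow> bool" where
  "output_nulling V \<longleftrightarrow>
     (\<forall>v \<in> V. \<exists>h \<in> carrier_vec q. A *\<^sub>v v + B *\<^sub>v h \<in> V \<and> C *\<^sub>v v + D *\<^sub>v h = 0\<^sub>v p)"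

text \<open>The columns of \<open>H\<close> are input values for the columns of a basis matrix \<open>P\<close> of \<open>V\<close>; the columns of
  \<open>L\<close> are the coordinates of the resulting next states in that basis.\<close>
lemma zero_triple_of_output_nulling:
  assumes V: "submodule class_ring V (module_vec TYPE(complex) n)" and null: "output_nulling V"
  obtains P H L where "zero_triple A B C D P H L" "mat_kernel P = {0\<^sub>v (dim_col P)}" "mat_image P = V"
proof -
  obtain P k where P: "P \<in> carrier_mat n k" and ker: "mat_kernel P = {0\<^sub>v k}" and img: "mat_image P = V"
    using subspace_has_basis_matrix[OF V] .
  have "\<exists>h l. h \<in> carrier_vec q \<and> l \<in> carrier_vec k \<and>
      A *\<^sub>v col P j + B *\<^sub>v h = P *\<^sub>v l \<and> C *\<^sub>v col P j + D *\<^sub>v h = 0\<^sub>v p" if j: "j < k" for j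
  proof -
    have "col P j = P *\<^sub>v unit_vec k j" using j P by (intro eq_vecI) auto
    then have "col P j \<in> V" using P unfolding img[symmetric] mat_image_def by auto
    then obtain h where h: "h \<in> carrier_vec q" "A *\<^sub>v col P j + B *\<^sub>v h \<in> V"
        "C *\<^sub>v col P j + D *\<^sub>v h = 0\<^sub>v p"
      using null unfolding output_nulling_def by blast
    from h(2) obtain l where "l \<in> carrier_vec k" "A *\<^sub>v col P j + B *\<^sub>v h = P *\<^sub>v l"
      using P unfolding img[symmetric] mat_image_def by auto
    with h show ?thesis by blast
  qed
  then obtain h l where hl: "\<And>j. j < k \<Longrightarrow> h j \<in> carrier_vec q" "\<And>j. j < k \<Longrightarrow> l j \<in> carrier_vec k"
    "\<And>j. j < k \<Longrightarrow> A *\<^sub>v col P j + B *\<^sub>v h j = P *\<^sub>v l j" "\<And>j. j < k \<Longrightarrow> C *\<^sub>v col P j + D *\<^sub>v h j = 0\<^sub>v p"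
    by metis
  define H where "H = mat_of_cols q (map h [0..<k])"
  define L where "L = mat_of_cols k (map l [0..<k])"
  have H: "H \<in> carrier_mat q k" and L: "L \<in> carrier_mat k k" by (simp_all add: H_def L_def mat_of_cols_def)
  have col: "col H j = h j" "col L j = l j" if "j < k" for j
    using that hl(1,2)[OF that] by (simp_all add: H_def L_def)
  have "A * P + B * H = P * L"
  proof (rule mat_col_eqI)
    fix j assume "j < dim_col (P * L)"
    then have j: "j < k" using L by simp
    have "col (A * P + B * H) j = A *\<^sub>v col P j + B *\<^sub>v col H j"
      unfolding col_mult2[OF A P j, symmetric] col_mult2[OF B H j, symmetric]
      using A B P H j by (intro col_add[of _ n k]) auto
    then show "col (A * P + B * H) j = col (P * L) j"
      unfolding col_mult2[OF P L j] col[OF j] using hl(3)[OF j] by simp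
  qed (use A B P H L in auto)
  moreover have "C * P + D * H = 0\<^sub>m p k"
  proof (rule mat_col_eqI)
    fix j assume "j < dim_col (0\<^sub>m p k :: complex mat)"
    then have j: "j < k" by simp
    have col_zero: "col (0\<^sub>m p k) j = (0\<^sub>v p :: complex vec)" using j by (intro eq_vecI) auto
    have "col (C * P + D * H) j = C *\<^sub>v col P j + D *\<^sub>v col H j"
      unfolding col_mult2[OF C P j, symmetric] col_mult2[OF D H j, symmetric]
      using C D P H j by (intro col_add[of _ p k]) auto
    then show "col (C * P + D * H) j = col (0\<^sub>m p k) j"
      unfolding col_zero col[OF j] using hl(4)[OF j] by simp
  qed (use C D P H in auto)
  ultimately have "zero_triple A B C D P H L" unfolding zero_triple_iff using P H L by blast
  then show ?thesis using that ker img P by auto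
qed

lemma output_nulling_of_zero_triple:
  assumes "zero_triple A B C D P H L"
  shows "submodule class_ring (mat_image P) (module_vec TYPE(complex) n)" and "output_nulling (mat_image P)"
proof -
  from assms obtain k where P: "P \<in> carrier_mat n k" and H: "H \<in> carrier_mat q k"
    and L: "L \<in> carrier_mat k k"
    and eqs: "A * P + B * H = P * L" "C * P + D * H = 0\<^sub>m p k"
    unfolding zero_triple_iff by blast
  interpret E: vec_space "TYPE(complex)" n .
  have "mat_image P = E.span (set (cols P))"
    using P unfolding E.col_space_def[symmetric] E.col_space_eq[OF P] mat_image_def by fastforce
  then show "submodule class_ring (mat_image P) E.V"
    using E.span_is_submodule[of "set (cols P)"] cols_dim[of P] P by simp
  show "output_nulling (mat_image P)" unfolding output_nulling_def
  proof
    fix v assume "v \<in> mat_image P"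
    then obtain x where x: "x \<in> carrier_vec k" and v: "v = P *\<^sub>v x" using P by (auto simp: mat_image_def)
    have "A *\<^sub>v v + B *\<^sub>v (H *\<^sub>v x) = (A * P + B * H) *\<^sub>v x"
      using A B P H x unfolding v
      by (simp add: add_mult_distrib_mat_vec[of _ n k] assoc_mult_mat_vec[of _ n n _ k]
          assoc_mult_mat_vec[of _ n q _ k])
    also have "\<dots> = P *\<^sub>v (L *\<^sub>v x)" unfolding eqs using P L x by simp
    finally have 1: "A *\<^sub>v v + B *\<^sub>v (H *\<^sub>v x) \<in> mat_image P" using P L x by (auto simp: mat_image_def)
    have "C *\<^sub>v v + D *\<^sub>v (H *\<^sub>v x) = (C * P + D * H) *\<^sub>v x"
      using C D P H x unfolding v
      by (simp add: add_mult_distrib_mat_vec[of _ p k] assoc_mult_mat_vec[of _ p n _ k]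
          assoc_mult_mat_vec[of _ p q _ k])
    also have "\<dots> = 0\<^sub>v p" unfolding eqs using x by (intro eq_vecI) (auto simp: scalar_prod_def)
    finally show "\<exists>h\<in>carrier_vec q. A *\<^sub>v v + B *\<^sub>v h \<in> mat_image P \<and> C *\<^sub>v v + D *\<^sub>v h = 0\<^sub>v p"
      using 1 H x by (intro bexI[of _ "H *\<^sub>v x"]) auto
  qed
qed

text \<open>The weakly unobservable subspace, described in the frequency domain.\<close>
definition output_nulling_states :: "complex vec set" where
  "output_nulling_states = {v \<in> carrier_vec n. \<exists>x \<in> sp n. \<exists>g \<in> sp q.
     indet \<cdot>\<^sub>v x = const_mat A *\<^sub>v x + (const_mat B *\<^sub>v g + const_vec v) \<and>
     const_mat C *\<^sub>v x + const_mat D *\<^sub>v g = 0\<^sub>v p}"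

lemma output_nulling_states_subspace:
  "submodule class_ring output_nulling_states (module_vec TYPE(complex) n)"
proof (rule submodule.intro[OF vec_module])
  let ?W = output_nulling_states
  show "?W \<subseteq> carrier (module_vec TYPE(complex) n)"
    by (auto simp: output_nulling_states_def module_vec_simps)
  show "\<zero>\<^bsub>module_vec TYPE(complex) n\<^esub> \<in> ?W"
    unfolding output_nulling_states_def module_vec_simps using const_carriers
    by (intro CollectI conjI bexI[OF _ strictly_proper_tuples_zero]) (auto simp: vec_eq_iff)
  fix v w assume "v \<in> ?W" "w \<in> ?W"
  then obtain x g y h where v: "v \<in> carrier_vec n" and w: "w \<in> carrier_vec n"
    and *: "x \<in> sp n" "g \<in> sp q" "y \<in> sp n" "h \<in> sp q"
    and eq: "indet \<cdot>\<^sub>v x = const_mat A *\<^sub>v x + (const_mat B *\<^sub>v g + const_vec v)"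
      "indet \<cdot>\<^sub>v y = const_mat A *\<^sub>v y + (const_mat B *\<^sub>v h + const_vec w)"
    and out: "const_mat C *\<^sub>v x + const_mat D *\<^sub>v g = 0\<^sub>v p" "const_mat C *\<^sub>v y + const_mat D *\<^sub>v h = 0\<^sub>v p"
    unfolding output_nulling_states_def by blast
  note c = *[THEN strictly_proper_tuples_carrier]
  have "indet \<cdot>\<^sub>v (x + y) = const_mat A *\<^sub>v (x + y) + (const_mat B *\<^sub>v (g + h) + const_vec (v + w))"
    unfolding smult_add_distrib_vec[OF c(1,3)] mult_add_distrib_mat_vec[OF const_carriers(1) c(1,3)]
      mult_add_distrib_mat_vec[OF const_carriers(2) c(2,4)] eq
    using A B v w by (auto simp: vec_eq_iff algebra_simps rat_const_hom.hom_add
        simp del: index_mult_mat_vec)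
  moreover have "const_mat C *\<^sub>v (x + y) + const_mat D *\<^sub>v (g + h) =
      (const_mat C *\<^sub>v x + const_mat D *\<^sub>v g) + (const_mat C *\<^sub>v y + const_mat D *\<^sub>v h)"
    unfolding mult_add_distrib_mat_vec[OF const_carriers(3) c(1,3)]
      mult_add_distrib_mat_vec[OF const_carriers(4) c(2,4)]
    using C D by (auto simp: vec_eq_iff algebra_simps simp del: index_mult_mat_vec)
  then have "const_mat C *\<^sub>v (x + y) + const_mat D *\<^sub>v (g + h) = 0\<^sub>v p" unfolding out by simp
  ultimately have "v + w \<in> ?W" unfolding output_nulling_states_def
    using add_carrier_vec[OF v w] strictly_proper_tuples_add[OF *(1,3)]
        strictly_proper_tuples_add[OF *(2,4)] by blast
  then show "v \<oplus>\<^bsub>module_vec TYPE(complex) n\<^esub> w \<in> ?W" by (simp add: module_vec_simps)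
next
  let ?W = output_nulling_states
  fix c v assume "v \<in> ?W"
  then obtain x g where v: "v \<in> carrier_vec n"
    and *: "x \<in> sp n" "g \<in> sp q"
    and eq: "indet \<cdot>\<^sub>v x = const_mat A *\<^sub>v x + (const_mat B *\<^sub>v g + const_vec v)"
    and out: "const_mat C *\<^sub>v x + const_mat D *\<^sub>v g = 0\<^sub>v p"
    unfolding output_nulling_states_def by blast
  note car = *[THEN strictly_proper_tuples_carrier]
  let ?c = "rat_const c"
  have "indet \<cdot>\<^sub>v (?c \<cdot>\<^sub>v x) = ?c \<cdot>\<^sub>v (indet \<cdot>\<^sub>v x)" by (simp add: smult_smult_assoc mult.commute)
  also have "\<dots> = const_mat A *\<^sub>v (?c \<cdot>\<^sub>v x) + (const_mat B *\<^sub>v (?c \<cdot>\<^sub>v g) + const_vec (c \<cdot>\<^sub>v v))"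
    unfolding eq mult_mat_vec[OF const_carriers(1) car(1)] mult_mat_vec[OF const_carriers(2) car(2)]
    using A B v by (auto simp: vec_eq_iff algebra_simps rat_const_hom.hom_mult simp del: index_mult_mat_vec)
  finally have 1: "indet \<cdot>\<^sub>v (?c \<cdot>\<^sub>v x) =
      const_mat A *\<^sub>v (?c \<cdot>\<^sub>v x) + (const_mat B *\<^sub>v (?c \<cdot>\<^sub>v g) + const_vec (c \<cdot>\<^sub>v v))" .
  have "const_mat C *\<^sub>v (?c \<cdot>\<^sub>v x) + const_mat D *\<^sub>v (?c \<cdot>\<^sub>v g) =
      ?c \<cdot>\<^sub>v (const_mat C *\<^sub>v x + const_mat D *\<^sub>v g)"
    unfolding mult_mat_vec[OF const_carriers(3) car(1)] mult_mat_vec[OF const_carriers(4) car(2)]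
    using C D by (auto simp: vec_eq_iff algebra_simps simp del: index_mult_mat_vec)
  then have "const_mat C *\<^sub>v (?c \<cdot>\<^sub>v x) + const_mat D *\<^sub>v (?c \<cdot>\<^sub>v g) = 0\<^sub>v p"
    unfolding out smult_zero_right .
  then have "c \<cdot>\<^sub>v v \<in> ?W" unfolding output_nulling_states_def
    using v 1 strictly_proper_tuples_smult[OF *(1), of c] strictly_proper_tuples_smult[OF *(2), of c]
    by auto
  then show "c \<odot>\<^bsub>module_vec TYPE(complex) n\<^esub> v \<in> ?W" by (simp add: module_vec_simps)
qed

text \<open>Shift a trajectory by one step: \<open>z x = v + x'\<close> and \<open>z g = h + g'\<close>, where the constant part of
  \<open>z x\<close> is \<open>v\<close> by the state equation. Then \<open>(x', g')\<close> is a trajectory with initial state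
  \<open>A v + B h\<close>, and the constant part of \<open>z (C x + D g) = 0\<close> is \<open>C v + D h\<close>.\<close>
lemma output_nulling_states_output_nulling: "output_nulling output_nulling_states"
  unfolding output_nulling_def
proof
  fix v assume "v \<in> output_nulling_states"
  then obtain x g where v: "v \<in> carrier_vec n"
    and x: "x \<in> sp n" and g: "g \<in> sp q"
    and eq: "indet \<cdot>\<^sub>v x = const_mat A *\<^sub>v x + (const_mat B *\<^sub>v g + const_vec v)"
    and out: "const_mat C *\<^sub>v x + const_mat D *\<^sub>v g = 0\<^sub>v p"
    unfolding output_nulling_states_def by blast
  note xc = strictly_proper_tuples_carrier[OF x] and gc = strictly_proper_tuples_carrier[OF g]
  obtain x0 x' where x0: "x0 \<in> carrier_vec n" and x': "x' \<in> sp n" and zx: "indet \<cdot>\<^sub>v x = const_vec x0 + x'"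
    using tuple_shift[OF x] .
  obtain h g' where h: "h \<in> carrier_vec q" and g': "g' \<in> sp q" and zg: "indet \<cdot>\<^sub>v g = const_vec h + g'"
    using tuple_shift[OF g] .
  note xc' = strictly_proper_tuples_carrier[OF x'] and gc' = strictly_proper_tuples_carrier[OF g']
  have "const_vec x0 + x' = const_vec v + (const_mat A *\<^sub>v x + const_mat B *\<^sub>v g)"
    using eq v A B unfolding zx by (auto simp: vec_eq_iff algebra_simps simp del: index_mult_mat_vec)
  note unique = poly_strictly_proper_unique[OF const_vec_poly[OF x0] const_vec_poly[OF v] x' _ this]
  have "const_mat A *\<^sub>v x + const_mat B *\<^sub>v g \<in> sp n"
    by (intro strictly_proper_tuples_add strictly_proper_tuples_mult[OF A]
        strictly_proper_tuples_mult[OF B] x g)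
  from unique[OF this] have x0v: "x0 = v" and x'_eq: "x' = const_mat A *\<^sub>v x + const_mat B *\<^sub>v g"
    by (auto dest: rat_const_hom.vec_hom_inj)
  have shift: "indet \<cdot>\<^sub>v (const_mat M *\<^sub>v x + const_mat N *\<^sub>v g) =
      const_vec (M *\<^sub>v v + N *\<^sub>v h) + (const_mat M *\<^sub>v x' + const_mat N *\<^sub>v g')"
    if M: "M \<in> carrier_mat m n" and N: "N \<in> carrier_mat m q" for M N m
  proof -
    have "indet \<cdot>\<^sub>v (const_mat M *\<^sub>v x + const_mat N *\<^sub>v g) =
        const_mat M *\<^sub>v (indet \<cdot>\<^sub>v x) + const_mat N *\<^sub>v (indet \<cdot>\<^sub>v g)"
      unfolding mult_mat_vec[OF const_mat_carrier[OF M] xc] mult_mat_vec[OF const_mat_carrier[OF N] gc]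
      using M N by (auto simp: vec_eq_iff algebra_simps simp del: index_mult_mat_vec)
    also have "\<dots> = (const_vec (M *\<^sub>v v) + const_mat M *\<^sub>v x') + (const_vec (N *\<^sub>v h) + const_mat N *\<^sub>v g')"
      unfolding zx zg x0v using mult_add_distrib_mat_vec[OF const_mat_carrier[OF M] _ xc', of "const_vec v"]
        mult_add_distrib_mat_vec[OF const_mat_carrier[OF N] _ gc', of "const_vec h"] v h
      by (simp add: rat_const_hom.mult_mat_vec_hom[OF M v] rat_const_hom.mult_mat_vec_hom[OF N h])
    also have "\<dots> = const_vec (M *\<^sub>v v + N *\<^sub>v h) + (const_mat M *\<^sub>v x' + const_mat N *\<^sub>v g')"
      using M N v h by (auto simp: vec_eq_iff algebra_simps rat_const_hom.hom_add
          simp del: index_mult_mat_vec)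
    finally show ?thesis .
  qed
  let ?v = "A *\<^sub>v v + B *\<^sub>v h"
  have v': "?v \<in> carrier_vec n" using A B v h by simp
  have "indet \<cdot>\<^sub>v x' = const_vec ?v + (const_mat A *\<^sub>v x' + const_mat B *\<^sub>v g')"
    using shift[OF A B] unfolding x'_eq[symmetric] .
  then have zx': "indet \<cdot>\<^sub>v x' = const_mat A *\<^sub>v x' + (const_mat B *\<^sub>v g' + const_vec ?v)"
    using A B v' by (auto simp: vec_eq_iff algebra_simps simp del: index_mult_mat_vec)
  have CD: "C *\<^sub>v v + D *\<^sub>v h \<in> carrier_vec p" using C D v h by simp
  have "const_vec (C *\<^sub>v v + D *\<^sub>v h) + (const_mat C *\<^sub>v x' + const_mat D *\<^sub>v g') = 0\<^sub>v p + 0\<^sub>v p"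
    using shift[OF C D, symmetric] unfolding out smult_zero_right by simp
  note unique = poly_strictly_proper_unique[OF
      const_vec_poly[OF CD] poly_tuples_zero _ strictly_proper_tuples_zero this]
  have "const_mat C *\<^sub>v x' + const_mat D *\<^sub>v g' \<in> sp p"
    by (intro strictly_proper_tuples_add strictly_proper_tuples_mult[OF C]
        strictly_proper_tuples_mult[OF D] x' g')
  from unique[OF this] have "C *\<^sub>v v + D *\<^sub>v h = 0\<^sub>v p"
    and out': "const_mat C *\<^sub>v x' + const_mat D *\<^sub>v g' = 0\<^sub>v p"
    by auto
  moreover have "?v \<in> output_nulling_states"
    unfolding output_nulling_states_def using v' x' g' zx' out' by blast
  ultimately show "\<exists>h\<in>carrier_vec q. A *\<^sub>v v + B *\<^sub>v h \<in> output_nulling_states \<and> C *\<^sub>v v + D *\<^sub>v h = 0\<^sub>v p"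
    using h by blast
qed

section \<open>The three assertions\<close>

text \<open>For a suitable reachable \<open>w\<close>, the output of the trajectory with input \<open>g\<close> and initial state
  \<open>w\<close> is polynomial. As \<open>g\<close> and the state are strictly proper, so is this output; hence it is zero.\<close>
lemma poly_preimage_initial_state:
  assumes g: "g \<in> sp q" and pre: "g \<in> poly_preimage_plus_poly F"
  obtains v where "v \<in> output_nulling_states"
    "F *\<^sub>v g + free_response v = 0\<^sub>v p"
proof -
  note gc = strictly_proper_tuples_carrier[OF g]
  obtain w where w: "w \<in> reachable_space A B"
    and poly: "F *\<^sub>v g + free_response w \<in> poly_tuples p"
    using pre unfolding poly_preimage_plus_poly_iff[OF gc] by blast
  have wc: "w \<in> carrier_vec n" using w reachable_carrier by blast
  have Bg: "const_mat B *\<^sub>v g \<in> sp n" by (rule strictly_proper_tuples_mult[OF B g])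
  note Bgc = strictly_proper_tuples_carrier[OF Bg]
  define x where "x = resolvent A *\<^sub>v (const_vec w + const_mat B *\<^sub>v g)"
  have x: "x \<in> sp n" unfolding x_def by (rule resolvent_strictly_proper[OF A wc Bg])
  note xc = strictly_proper_tuples_carrier[OF x]
  have "indet \<cdot>\<^sub>v x = const_mat A *\<^sub>v x + (const_vec w + const_mat B *\<^sub>v g)"
    using resolvent_eq_iff[OF A xc, of "const_vec w + const_mat B *\<^sub>v g"] Bgc wc by (simp add: x_def)
  also have "const_vec w + const_mat B *\<^sub>v g = const_mat B *\<^sub>v g + const_vec w"
    using Bgc wc by (intro comm_add_vec[of _ n]) auto
  finally have zx: "indet \<cdot>\<^sub>v x = const_mat A *\<^sub>v x + (const_mat B *\<^sub>v g + const_vec w)" .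
  note out = state_space_output[OF xc gc wc zx]
  have "const_mat C *\<^sub>v x + const_mat D *\<^sub>v g \<in> sp p"
    by (intro strictly_proper_tuples_add strictly_proper_tuples_mult[OF C]
        strictly_proper_tuples_mult[OF D] x g)
  then have zero: "const_mat C *\<^sub>v x + const_mat D *\<^sub>v g = 0\<^sub>v p"
    using poly_strictly_proper_zero poly unfolding out by blast
  have "w \<in> output_nulling_states"
    unfolding output_nulling_states_def using wc x g zx zero by blast
  then show ?thesis using that out zero by simp
qed

lemma difference_in_strictly_proper_kernel:
  assumes g: "g \<in> sp q" and h: "h \<in> sp q" and y: "y \<in> carrier_vec p"
    and eq: "F *\<^sub>v g + y = 0\<^sub>v p" "F *\<^sub>v h + y = 0\<^sub>v p"
  shows "g - h \<in> strictly_proper_kernel F"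
proof -
  note c = g[THEN strictly_proper_tuples_carrier] h[THEN strictly_proper_tuples_carrier]
  have "(F *\<^sub>v g) $ i = (F *\<^sub>v h) $ i" if "i < p" for i
    using arg_cong[OF eq(1), of "\<lambda>v. v $ i"] arg_cong[OF eq(2), of "\<lambda>v. v $ i"] that y F_carrier
    by (simp del: index_mult_mat_vec add: add_eq_0_iff2)
  then have "F *\<^sub>v g - F *\<^sub>v h = 0\<^sub>v p" using F_carrier
    by (auto simp: vec_eq_iff simp del: index_mult_mat_vec)
  then have "F *\<^sub>v (g - h) = 0\<^sub>v p" using mult_minus_distrib_mat_vec[OF F_carrier c] by simp
  then show ?thesis
    unfolding strictly_proper_kernel_def using F_carrier strictly_proper_tuples_diff[OF g h] c
    by (simp add: mat_kernel[OF F_carrier])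
qed

lemma free_response_carrier:
  "v \<in> carrier_vec n \<Longrightarrow> free_response v \<in> carrier_vec p"
  by (intro mult_mat_vec_carrier[OF const_carriers(3)] resolvent_closed[OF A]) simp

text \<open>The triple is built from the weakly unobservable subspace. For \<open>v = \<Pi>\<alpha>\<close>, both \<open>F g\<close> and
  \<open>F H(zI - \<Lambda>)\<inverse>\<alpha>\<close> are the negative of the free response of \<open>v\<close>.\<close>
lemma fzk_triple_exists: "\<exists>P H L. fzk_triple A B C D P H L"
proof -
  obtain P H L where triple: "zero_triple A B C D P H L" and ker: "mat_kernel P = {0\<^sub>v (dim_col P)}"
    and img: "mat_image P = output_nulling_states"
    using zero_triple_of_output_nulling[OF output_nulling_states_subspace output_nulling_states_output_nulling] .
  from triple obtain k where P: "P \<in> carrier_mat n k" and H: "H \<in> carrier_mat q k"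
    and L: "L \<in> carrier_mat k k"
    and eqs: "A * P + B * H = P * L" "C * P + D * H = 0\<^sub>m p k"
    unfolding zero_triple_iff by blast
  have "\<exists>\<alpha>\<in>carrier_vec (dim_col H). g - (const_mat H * resolvent L) *\<^sub>v const_vec \<alpha> \<in>
      strictly_proper_kernel F"
    if g: "g \<in> sp q" and pre: "g \<in> poly_preimage_plus_poly F" for g
  proof -
    obtain v where v: "v \<in> output_nulling_states"
      and Fg: "F *\<^sub>v g + free_response v = 0\<^sub>v p"
      using poly_preimage_initial_state[OF g pre] .
    obtain a where a: "a \<in> carrier_vec k" and va: "v = P *\<^sub>v a"
      using v P unfolding img[symmetric] mat_image_def by auto
    have vc: "v \<in> carrier_vec n" using va P a by simp
    from zero_triple_response[OF P H L eqs a]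
    have "g - (const_mat H * resolvent L) *\<^sub>v const_vec a \<in> strictly_proper_kernel F"
      using difference_in_strictly_proper_kernel[OF g _ free_response_carrier[OF vc] Fg] unfolding va
      by blast
    then show ?thesis using a H by auto
  qed
  then show ?thesis unfolding fzk_triple_def using triple ker B by blast
qed

lemma free_response_diff:
  assumes "v \<in> carrier_vec n" "w \<in> carrier_vec n"
  shows "free_response (v - w) = free_response v - free_response w"
proof -
  have "const_vec (v - w) = const_vec v - const_vec w"
    using assms by (intro eq_vecI) (auto simp: rat_const_hom.hom_minus)
  then have "resolvent A *\<^sub>v const_vec (v - w) = resolvent A *\<^sub>v const_vec v - resolvent A *\<^sub>v const_vec w"
    using mult_minus_distrib_mat_vec[OF resolvent_carrier, of "const_vec v" "const_vec w"] assms by simp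
  then show ?thesis
    using mult_minus_distrib_mat_vec[OF const_carriers(3) resolvent_closed[OF A]
        resolvent_closed[OF A], of "const_vec v" "const_vec w"] assms
    by simp
qed

text \<open>As \<open>F g\<close> is the negative of the free response of \<open>\<Pi>G\<close>, membership asks for a reachable \<open>w\<close> such
  that the free response of \<open>w - \<Pi>G\<close> is polynomial. Observability leaves only \<open>w = \<Pi>G\<close>.\<close>
lemma zero_triple_in_poly_preimage_iff:
  assumes obs: "observable C A" and triple: "zero_triple A B C D P H L" and G: "G \<in> carrier_vec (dim_col P)"
  shows "(const_mat H * resolvent L) *\<^sub>v const_vec G \<in> poly_preimage_plus_poly F \<longleftrightarrow>
    P *\<^sub>v G \<in> reachable_space A B"
proof -
  from triple obtain k where P: "P \<in> carrier_mat n k" and H: "H \<in> carrier_mat q k"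
    and L: "L \<in> carrier_mat k k"
    and eqs: "A * P + B * H = P * L" "C * P + D * H = 0\<^sub>m p k"
    unfolding zero_triple_iff by blast
  have G: "G \<in> carrier_vec k" using G P by simp
  define g where "g = (const_mat H * resolvent L) *\<^sub>v const_vec G"
  note resp = zero_triple_response[OF P H L eqs G, folded g_def]
  note gc = strictly_proper_tuples_carrier[OF resp(1)]
  have PG: "P *\<^sub>v G \<in> carrier_vec n" using P G by simp
  have diff: "F *\<^sub>v g + free_response w = free_response (w - P *\<^sub>v G)" if w: "w \<in> carrier_vec n" for w
  proof -
    have "(F *\<^sub>v g) $ i = - free_response (P *\<^sub>v G) $ i" if "i < p" for i
      using arg_cong[OF resp(2), of "\<lambda>v. v $ i"] that C F_carrier
      by (simp del: index_mult_mat_vec add: eq_neg_iff_add_eq_0)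
    then show ?thesis unfolding free_response_diff[OF w PG] using C F_carrier
      by (auto simp: vec_eq_iff simp del: index_mult_mat_vec)
  qed
  have "g \<in> poly_preimage_plus_poly F \<longleftrightarrow> (\<exists>w \<in> reachable_space A B. free_response (w - P *\<^sub>v G) \<in>
      poly_tuples p)"
    unfolding poly_preimage_plus_poly_iff[OF gc] using diff reachable_carrier by (metis subsetD)
  also have "\<dots> \<longleftrightarrow> P *\<^sub>v G \<in> reachable_space A B"
  proof
    assume "\<exists>w \<in> reachable_space A B. free_response (w - P *\<^sub>v G) \<in> poly_tuples p"
    then obtain w where w: "w \<in> reachable_space A B"
      and poly: "free_response (w - P *\<^sub>v G) \<in> poly_tuples p" by blast
    have wc: "w \<in> carrier_vec n" using w reachable_carrier by blast
    then have "w - P *\<^sub>v G = 0\<^sub>v n" using free_response_poly_imp_zero[OF obs _ poly] PG by simp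
    then have "w = P *\<^sub>v G" using wc PG by (auto simp: vec_eq_iff simp del: index_mult_mat_vec)
    then show "P *\<^sub>v G \<in> reachable_space A B" using w by simp
  next
    assume "P *\<^sub>v G \<in> reachable_space A B"
    moreover have "free_response (P *\<^sub>v G - P *\<^sub>v G) = 0\<^sub>v p"
      unfolding free_response_diff[OF PG PG] using C by (auto simp: vec_eq_iff)
    ultimately show "\<exists>w \<in> reachable_space A B. free_response (w - P *\<^sub>v G) \<in> poly_tuples p"
      using poly_tuples_zero by metis
  qed
  finally show ?thesis unfolding g_def .
qed

text \<open>For \<open>v = \<Pi>G\<close> reachable, the function \<open>g = H(zI - \<Lambda>)\<inverse>G\<close> is represented modulo the kernel by
  some \<open>h = H'(zI - \<Lambda>')\<inverse>a\<close>. Then \<open>F g = F h\<close>, so \<open>v\<close> and \<open>\<Pi>'a\<close> have the same free response and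
  agree by observability.\<close>
lemma zero_triple_image_in_fzk_image:
  assumes obs: "observable C A" and triple: "zero_triple A B C D P H L"
    and reach: "mat_image P \<subseteq> reachable_space A B" and fzk: "fzk_triple A B C D P' H' L'"
  shows "mat_image P \<subseteq> mat_image P'"
proof
  fix v assume v: "v \<in> mat_image P"
  from triple obtain k where P: "P \<in> carrier_mat n k" and H: "H \<in> carrier_mat q k"
    and L: "L \<in> carrier_mat k k"
    and eqs: "A * P + B * H = P * L" "C * P + D * H = 0\<^sub>m p k"
    unfolding zero_triple_iff by blast
  from fzk obtain k' where P': "P' \<in> carrier_mat n k'" and H': "H' \<in> carrier_mat q k'"
    and L': "L' \<in> carrier_mat k' k'"
    and eqs': "A * P' + B * H' = P' * L'" "C * P' + D * H' = 0\<^sub>m p k'"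
    unfolding fzk_triple_def zero_triple_iff by blast
  obtain G where G: "G \<in> carrier_vec k" and vG: "v = P *\<^sub>v G" using v P by (auto simp: mat_image_def)
  define g where "g = (const_mat H * resolvent L) *\<^sub>v const_vec G"
  note resp = zero_triple_response[OF P H L eqs G, folded g_def]
  have "g \<in> poly_preimage_plus_poly F"
    unfolding g_def using zero_triple_in_poly_preimage_iff[OF obs triple, of G] G P v vG reach by auto
  then obtain a where a: "a \<in> carrier_vec k'"
    and ker: "g - (const_mat H' * resolvent L') *\<^sub>v const_vec a \<in> strictly_proper_kernel F"
    using fzk resp(1) B H' unfolding fzk_triple_def by auto
  define h where "h = (const_mat H' * resolvent L') *\<^sub>v const_vec a"
  note resp' = zero_triple_response[OF P' H' L' eqs' a, folded h_def]
  note c = resp(1)[THEN strictly_proper_tuples_carrier] resp'(1)[THEN strictly_proper_tuples_carrier]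
  have vc: "v \<in> carrier_vec n" and ac: "P' *\<^sub>v a \<in> carrier_vec n" using vG P G P' a by auto
  have "F *\<^sub>v (g - h) = 0\<^sub>v p"
    using ker unfolding h_def[symmetric] strictly_proper_kernel_def by (simp add: mat_kernel[OF F_carrier])
  then have Fgh: "F *\<^sub>v g - F *\<^sub>v h = 0\<^sub>v p" unfolding mult_minus_distrib_mat_vec[OF F_carrier c] .
  have "free_response (v - P' *\<^sub>v a) = 0\<^sub>v p"
  proof (rule eq_vecI)
    fix i assume "i < dim_vec (0\<^sub>v p :: ratfun vec)"
    then have i: "i < p" by simp
    have "free_response v $ i = - (F *\<^sub>v g) $ i" "free_response (P' *\<^sub>v a) $ i = - (F *\<^sub>v h) $ i"
        "(F *\<^sub>v g) $ i = (F *\<^sub>v h) $ i"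
      using arg_cong[OF resp(2), of "\<lambda>v. v $ i"] arg_cong[OF resp'(2), of "\<lambda>v. v $ i"]
          arg_cong[OF Fgh, of "\<lambda>v. v $ i"]
        i C F_carrier unfolding vG
          by (simp_all del: index_mult_mat_vec add: eq_neg_iff_add_eq_0 add.commute)
    then show "free_response (v - P' *\<^sub>v a) $ i = 0\<^sub>v p $ i"
      unfolding free_response_diff[OF vc ac] using i C by (simp del: index_mult_mat_vec)
  qed (use C in simp)
  then have "v - P' *\<^sub>v a = 0\<^sub>v n"
    using free_response_poly_imp_zero[OF obs, of "v - P' *\<^sub>v a"] vc ac poly_tuples_zero by simp
  then have "v = P' *\<^sub>v a" using vc ac by (auto simp: vec_eq_iff simp del: index_mult_mat_vec)
  then show "v \<in> mat_image P'" using a P' by (auto simp: mat_image_def)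
qed

text \<open>The class of the \<open>j\<close>-th column depends only on the \<open>j\<close>-th column of \<open>P\<close>. If that column is
  \<open>P' t\<close>, then \<open>H'(zI - L')\<inverse>t\<close> has the same class.\<close>
lemma generated_classes_mono_image:
  assumes triple: "zero_triple A B C D P H L" and triple': "zero_triple A B C D P' H' L'"
    and img: "mat_image P \<subseteq> mat_image P'"
  shows "generated_classes F (const_mat H * resolvent L) \<subseteq>
      generated_classes F (const_mat H' * resolvent L')"
proof -
  have response: "set (cols (const_mat H * resolvent L)) \<subseteq> sp q"
    "v \<in> set (cols (const_mat H * resolvent L)) \<Longrightarrow>
      \<exists>j < dim_col P. v = (const_mat H * resolvent L) *\<^sub>v const_vec (unit_vec (dim_col P) j)"
    if "zero_triple A B C D P H L" for P H L v
  proof -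
    from that obtain k where P: "P \<in> carrier_mat n k" and H: "H \<in> carrier_mat q k"
      and L: "L \<in> carrier_mat k k"
      and eqs: "A * P + B * H = P * L" "C * P + D * H = 0\<^sub>m p k"
      unfolding zero_triple_iff by blast
    have M: "const_mat H * resolvent L \<in> carrier_mat q k" using H resolvent_inverse(1)[OF L] by simp
    have col: "col (const_mat H * resolvent L) j =
        (const_mat H * resolvent L) *\<^sub>v const_vec (unit_vec k j)" if "j < k" for j
    proof -
      have "const_vec (unit_vec k j) = unit_vec k j" by (intro eq_vecI) (auto simp: unit_vec_def)
      then show ?thesis using M that by (intro eq_vecI) auto
    qed
    show "\<exists>j < dim_col P. v = (const_mat H * resolvent L) *\<^sub>v const_vec (unit_vec (dim_col P) j)"
      if v: "v \<in> set (cols (const_mat H * resolvent L))"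
    proof -
      obtain j where j: "j < k" "v = col (const_mat H * resolvent L) j" using v M by (auto simp: cols_def)
      have "dim_col P = k" using P by simp
      with j col[OF j(1)] show ?thesis by blast
    qed
    show "set (cols (const_mat H * resolvent L)) \<subseteq> sp q"
      using M col zero_triple_response(1)[OF P H L eqs] by (auto simp: cols_def)
  qed
  from triple obtain k where P: "P \<in> carrier_mat n k" and H: "H \<in> carrier_mat q k"
    and L: "L \<in> carrier_mat k k"
    and eqs: "A * P + B * H = P * L" "C * P + D * H = 0\<^sub>m p k"
    unfolding zero_triple_iff by blast
  from triple' obtain k' where P': "P' \<in> carrier_mat n k'" and H': "H' \<in> carrier_mat q k'"
    and L': "L' \<in> carrier_mat k' k'"
    and eqs': "A * P' + B * H' = P' * L'" "C * P' + D * H' = 0\<^sub>m p k'"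
    unfolding zero_triple_iff by blast
  have dims: "dim_col F = q" "dim_row (const_mat H' * resolvent L') = q"
      "dim_col (const_mat H' * resolvent L') = k'"
    using F_carrier H' resolvent_inverse(1)[OF L'] by auto
  show ?thesis
  proof (rule generated_classes_subset)
    fix v assume "v \<in> set (cols (const_mat H * resolvent L))"
    then obtain j where j: "j < k" and v: "v = (const_mat H * resolvent L) *\<^sub>v const_vec (unit_vec k j)"
      using response(2)[OF triple] P by auto
    have e: "unit_vec k j \<in> carrier_vec k" by simp
    have "P *\<^sub>v unit_vec k j \<in> mat_image P'" using img P e unfolding mat_image_def by blast
    then obtain t where t: "t \<in> carrier_vec k'" and eq: "P *\<^sub>v unit_vec k j = P' *\<^sub>v t"
      using P' by (auto simp: mat_image_def)
    have c: "P' *\<^sub>v t \<in> carrier_vec n" using P' t by simp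
    have "v - (const_mat H' * resolvent L') *\<^sub>v const_vec t \<in> strictly_proper_kernel F"
      using difference_in_strictly_proper_kernel[OF zero_triple_response(1)[OF P H L eqs e]
        zero_triple_response(1)[OF P' H' L' eqs' t] free_response_carrier[OF c]]
        zero_triple_response(2)[OF P H L eqs e] zero_triple_response(2)[OF P' H' L' eqs' t]
      unfolding v eq by blast
    then show "\<exists>t\<in>carrier_vec (dim_col (const_mat H' * resolvent L')).
        v - (const_mat H' * resolvent L') *\<^sub>v const_vec t \<in> strictly_proper_kernel F"
      using t dims by auto
  qed (use response(1)[OF triple] response(1)[OF triple'] dims in simp_all)
qed

lemma zero_triple_reduction:
  assumes triple: "zero_triple A B C D P H L"
  shows "\<exists>P' H' L'. zero_triple A B C D P' H' L' \<and> mat_kernel P' = {0\<^sub>v (dim_col P')} \<and>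
    mat_image P' = mat_image P \<and>
    generated_classes F (const_mat H' * resolvent L') = generated_classes F (const_mat H * resolvent L)"
proof -
  obtain P' H' L' where triple': "zero_triple A B C D P' H' L'" and "mat_kernel P' = {0\<^sub>v (dim_col P')}"
    and img: "mat_image P' = mat_image P"
    using zero_triple_of_output_nulling[OF output_nulling_of_zero_triple[OF triple]] .
  moreover have "generated_classes F (const_mat H' * resolvent L') =
      generated_classes F (const_mat H * resolvent L)"
    using generated_classes_mono_image[OF triple' triple]
        generated_classes_mono_image[OF triple triple'] img by simp
  ultimately show ?thesis by blast
qed

end

theorem theorem3p3:
  fixes A B C D :: "complex mat" and F :: "ratfun mat" and n p q :: nat
  assumes "A \<in> carrier_mat n n" and "B \<in> carrier_mat n q"
    and "C \<in> carrier_mat p n" and "D \<in> carrier_mat p q"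
    and "F = transfer_function A B C D"
  shows
    "(observable C A \<longrightarrow> (\<exists>P\<^sub>f H\<^sub>f \<Lambda>\<^sub>f. fzk_triple A B C D P\<^sub>f H\<^sub>f \<Lambda>\<^sub>f)) \<and>
     (\<forall>P\<^sub>1 H\<^sub>1 \<Lambda>\<^sub>1. zero_triple A B C D P\<^sub>1 H\<^sub>1 \<Lambda>\<^sub>1 \<longrightarrow>
        (\<exists>P' H' \<Lambda>'. zero_triple A B C D P' H' \<Lambda>' \<and>
           mat_kernel P' = {0\<^sub>v (dim_col P')} \<and>
           mat_image P' = mat_image P\<^sub>1 \<and>
           generated_classes F (const_mat H' * resolvent \<Lambda>') =
             generated_classes F (const_mat H\<^sub>1 * resolvent \<Lambda>\<^sub>1)) \<and>
        (observable C A \<and> mat_image P\<^sub>1 \<subseteq> reachable_space A B \<longrightarrow>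
           (\<forall>P\<^sub>f H\<^sub>f \<Lambda>\<^sub>f. fzk_triple A B C D P\<^sub>f H\<^sub>f \<Lambda>\<^sub>f \<longrightarrow> mat_image P\<^sub>1 \<subseteq> mat_image P\<^sub>f))) \<and>
     (observable C A \<longrightarrow>
        (\<forall>P\<^sub>1 H\<^sub>1 \<Lambda>\<^sub>1. zero_triple A B C D P\<^sub>1 H\<^sub>1 \<Lambda>\<^sub>1 \<longrightarrow>
           (\<forall>G\<^sub>1 \<in> carrier_vec (dim_col P\<^sub>1).
              (const_mat H\<^sub>1 * resolvent \<Lambda>\<^sub>1) *\<^sub>v const_vec G\<^sub>1 \<in> poly_preimage_plus_poly F \<longleftrightarrow>
              P\<^sub>1 *\<^sub>v G\<^sub>1 \<in> reachable_space A B)))"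
proof -
  interpret linear_system A B C D n p q by (rule linear_system.intro[OF assms(1-4)])
  show ?thesis unfolding assms(5)
    by (intro conjI impI allI ballI fzk_triple_exists zero_triple_reduction zero_triple_in_poly_preimage_iff)
      (auto dest: zero_triple_image_in_fzk_image)
qed

end
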